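(* Let $F$ be a field with $\operatorname{char} F\neq 2$, and let $\boldsymbol\varepsilon$ be an $n\times n$ elementary quantum matrix over $F$. Then there exists $l\ge 0$ such that $\boldsymbol\varepsilon\cong \mathbf h_{l,n}$, where $$\mathbf h_{l,n}=\underbrace{\mathbf h\times\cdots\times\mathbf h}_{l\text{ times}}\times\mathbf 1_{n-2l}\quad\text{and}\quad \mathbf h=\begin{pmatrix}1&-1\\-1&1\end{pmatrix}.$$ Also, there exists a $\langle\boldsymbol\sigma_1,\dots,\boldsymbol\sigma_n\rangle$-grading of $F_{\boldsymbol\varepsilon}$ such that the grading group of the centre $Z(F_{\boldsymbol\varepsilon})$ is equal to $$2\mathbb Z\boldsymbol\sigma_1+\cdots+2\mathbb Z\boldsymbol\sigma_{2l}+\mathbb Z\boldsymbol\sigma_{2l+1}+\cdots+\mathbb Z\boldsymbol\sigma_n .$$ Moreover, the number $l$ is an isomorphism invariant of $F_{\boldsymbol\varepsilon}$.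
   Context: A quantum matrix is an $n\times n$ matrix $\mathbf q=(q_{ij})$ over $F$ with $q_{ii}=1$ and $q_{ji}=q_{ij}^{-1}$; it is elementary if every $q_{ij}\in\{1,-1\}$. The quantum torus $F_{\mathbf q}=F_{\mathbf q}[t_1^{\pm1},\dots,t_n^{\pm1}]$ is the associative $F$-algebra with generators $t_1^{\pm1},\dots,t_n^{\pm1}$ and relations $t_it_i^{-1}=t_i^{-1}t_i=1$, $t_jt_i=q_{ij}t_it_j$ for all $1\le i,j\le n$. Write $\mathbf q\cong\boldsymbol\eta$ if $F_{\mathbf q}\cong F_{\boldsymbol\eta}$ as $F$-algebras. $\Lambda$ is the free abelian group of rank $n$. For a basis $\{\boldsymbol\sigma_1,\dots,\boldsymbol\sigma_n\}$ of $\Lambda$, giving $t_{\boldsymbol\alpha}:=t_1^{\alpha_1}\cdots t_n^{\alpha_n}$ the degree $\boldsymbol\alpha=\alpha_1\boldsymbol\sigma_1+\cdots+\alpha_n\boldsymbol\sigma_n$ makes $F_{\mathbf q}=\bigoplus_{\boldsymbol\alpha\in\Lambda}Ft_{\boldsymbol\alpha}$ a $\Lambda$-graded algebra; this grading is called the toral $\Lambda$-grading determined by $\langle\boldsymbol\sigma_1,\dots,\boldsymbol\sigma_n\rangle$, or a $\langle\boldsymbol\sigma_1,\dots,\boldsymbol\sigma_n\rangle$-grading. With respect to such a grading, the centre $Z(F_{\mathbf q})$ is graded by a subgroup of $\Lambda$, called its grading group: the set of degrees $\boldsymbol\alpha$ with $Z(F_{\mathbf q})\cap Ft_{\boldsymbol\alpha}\ne0$.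 For square matrices $A_1,\dots,A_r$, $A_1\times\cdots\times A_r$ denotes the block matrix with diagonal blocks $A_1,\dots,A_r$ and all entries outside these blocks equal to $1$. $\mathbf 1_k$ is the $k\times k$ matrix with all entries $1$. The matrix $\mathbf h_{l,n}$ is $n\times n$, with $0\le 2l\le n$. *)

theory Defs
  imports
    "HOL-Algebra.QuotRing"
    "HOL-Algebra.Module"
    "HOL-Algebra.Free_Abelian_Groups"
    "HOL-Library.Poly_Mapping"
    "Jordan_Normal_Form.Matrix"
begin

section \<open>Algebras given by generators and relations\<close>

text \<open>
  A unital associative algebra over a field is a HOL-Algebra ring together with a scalar
  multiplication. The record type \<open>module\<close> carries exactly this data; the locale
  \<open>algebra\<close> is not used because it requires commutativity.

  The free algebra is the monoid algebra of the free monoid, obtained from the convolution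
  product of \<open>Poly_Mapping\<close>. That product is indexed by additive monoids, so words form
  an additive monoid in which addition is concatenation.
\<close>

datatype 'x word = Word (letters: "'x list")

instantiation word :: (type) monoid_add
begin

definition zero_word :: "'a word" where "0 = Word []"

definition plus_word :: "'a word \<Rightarrow> 'a word \<Rightarrow> 'a word" where
  "v + w = Word (letters v @ letters w)"

instance by standard (auto simp: zero_word_def plus_word_def)

end

definition free_algebra :: "'x set \<Rightarrow> ('a::field, 'x word \<Rightarrow>\<^sub>0 'a) module" where
  "free_algebra X =
    \<lparr>carrier = {f. \<forall>w \<in> Poly_Mapping.keys f. set (letters w) \<subseteq> X},
     monoid.mult = (*), one = 1, ring.zero = 0, ring.add = (+),
     smult = (\<lambda>c f. Poly_Mapping.single 0 c * f)\<rparr>"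

definition free_gen :: "'x \<Rightarrow> 'x word \<Rightarrow>\<^sub>0 'a::field" where
  "free_gen x = Poly_Mapping.single (Word [x]) 1"

definition quotient_algebra :: "('a, 'b) module \<Rightarrow> 'b set \<Rightarrow> ('a, 'b set) module" where
  "quotient_algebra A I =
     ring.extend (A Quot I) (module.fields (\<lambda>c X. \<Union>x\<in>X. I +>\<^bsub>A\<^esub> (c \<odot>\<^bsub>A\<^esub> x)))"

definition presented_algebra ::
  "'x set \<Rightarrow> ('x word \<Rightarrow>\<^sub>0 'a::field) set \<Rightarrow> ('a, ('x word \<Rightarrow>\<^sub>0 'a) set) module" where
  "presented_algebra X R = quotient_algebra (free_algebra X) (Idl\<^bsub>free_algebra X\<^esub> R)"

definition presented_gen ::
  "'x set \<Rightarrow> ('x word \<Rightarrow>\<^sub>0 'a::field) set \<Rightarrow> 'x \<Rightarrow> ('x word \<Rightarrow>\<^sub>0 'a) set" where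
  "presented_gen X R x = Idl\<^bsub>free_algebra X\<^esub> R +>\<^bsub>free_algebra X\<^esub> free_gen x"

definition algebra_isos :: "('a, 'b) module \<Rightarrow> ('a, 'c) module \<Rightarrow> ('b \<Rightarrow> 'c) set" where
  "algebra_isos A B =
     {\<phi> \<in> ring_iso A B. \<forall>c. \<forall>x\<in>carrier A. \<phi> (c \<odot>\<^bsub>A\<^esub> x) = c \<odot>\<^bsub>B\<^esub> \<phi> x}"

definition algebra_isomorphic :: "('a, 'b) module \<Rightarrow> ('a, 'c) module \<Rightarrow> bool" where
  "algebra_isomorphic A B \<longleftrightarrow> algebra_isos A B \<noteq> {}"

definition centre :: "('b, 'm) ring_scheme \<Rightarrow> 'b set" where
  "centre A = {z \<in> carrier A. \<forall>x\<in>carrier A. z \<otimes>\<^bsub>A\<^esub> x = x \<otimes>\<^bsub>A\<^esub> z}"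

lemma ring_free_algebra: "ring (free_algebra X :: ('a::field, 'x word \<Rightarrow>\<^sub>0 'a) module)"
proof (rule ringI)
  let ?A = "free_algebra X :: ('a, 'x word \<Rightarrow>\<^sub>0 'a) module"
  have add: "f + g \<in> carrier ?A" if "f \<in> carrier ?A" "g \<in> carrier ?A" for f g
    using that Poly_Mapping.keys_add[of f g] by (auto simp: free_algebra_def)
  have mult: "f * g \<in> carrier ?A" if f: "f \<in> carrier ?A" and g: "g \<in> carrier ?A" for f g
    unfolding free_algebra_def
  proof (simp, intro ballI)
    fix w assume "w \<in> Poly_Mapping.keys (f * g)"
    then obtain u v where "w = u + v" "u \<in> Poly_Mapping.keys f" "v \<in> Poly_Mapping.keys g"
      using keys_mult[of f g] by blast
    with f g show "set (letters w) \<subseteq> X"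
      by (simp add: free_algebra_def plus_word_def)
  qed
  have neg: "\<exists>g\<in>carrier ?A. g \<oplus>\<^bsub>?A\<^esub> f = \<zero>\<^bsub>?A\<^esub>" if "f \<in> carrier ?A" for f
    using that by (intro bexI[of _ "- f"]) (simp_all add: free_algebra_def)
  have one: "1 \<in> carrier ?A"
    by (simp add: free_algebra_def zero_word_def flip: single_one)
  have ops [simp]: "f \<oplus>\<^bsub>?A\<^esub> g = f + g" "f \<otimes>\<^bsub>?A\<^esub> g = f * g" "\<zero>\<^bsub>?A\<^esub> = 0" "\<one>\<^bsub>?A\<^esub> = 1"
    for f g by (simp_all add: free_algebra_def)
  have zero: "0 \<in> carrier ?A"
    by (simp add: free_algebra_def)
  show "abelian_group ?A"
    by (rule abelian_groupI) (use add neg zero in \<open>simp_all add: add.assoc add.commute\<close>)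
  show "Group.monoid ?A"
    by (rule monoidI) (use mult one in \<open>simp_all add: mult.assoc\<close>)
qed (simp_all add: free_algebra_def distrib_left distrib_right)

section \<open>Quantum matrices\<close>

text \<open>
  Matrix indices run over \<open>0..<n\<close>. Since \<open>inverse 0 = 0\<close> in HOL, invertibility of the
  entries has to be required separately.
\<close>

definition quantum_matrix :: "nat \<Rightarrow> 'a::field mat \<Rightarrow> bool" where
  "quantum_matrix n q \<longleftrightarrow>
     q \<in> carrier_mat n n \<and>
     (\<forall>i<n. q $$ (i, i) = 1) \<and>
     (\<forall>i<n. \<forall>j<n. q $$ (i, j) \<noteq> 0 \<and> q $$ (j, i) = inverse (q $$ (i, j)))"

definition elementary_quantum_matrix :: "nat \<Rightarrow> 'a::field mat \<Rightarrow> bool" where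
  "elementary_quantum_matrix n q \<longleftrightarrow>
     quantum_matrix n q \<and> (\<forall>i<n. \<forall>j<n. q $$ (i, j) \<in> {1, -1})"

definition ones_mat :: "nat \<Rightarrow> nat \<Rightarrow> 'a::one mat" where
  "ones_mat m n = mat m n (\<lambda>_. 1)"

definition block_product :: "'a::one mat \<Rightarrow> 'a mat \<Rightarrow> 'a mat" where
  "block_product A B =
     four_block_mat A (ones_mat (dim_row A) (dim_col B)) (ones_mat (dim_row B) (dim_col A)) B"

definition h_block :: "'a::field mat" where
  "h_block = mat_of_rows_list 2 [[1, -1], [-1, 1]]"

definition h_mat :: "nat \<Rightarrow> nat \<Rightarrow> 'a::field mat" where
  "h_mat l n = (block_product h_block ^^ l) (ones_mat (n - 2 * l) (n - 2 * l))"

section \<open>Quantum tori\<close>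

datatype torus_letter = T nat | Tinv nat

definition torus_letters :: "nat \<Rightarrow> torus_letter set" where
  "torus_letters n = T ` {..<n} \<union> Tinv ` {..<n}"

definition torus_relators :: "'a::field mat \<Rightarrow> (torus_letter word \<Rightarrow>\<^sub>0 'a) set" where
  "torus_relators q =
     {free_gen (T i) * free_gen (Tinv i) - 1 | i. i < dim_row q} \<union>
     {free_gen (Tinv i) * free_gen (T i) - 1 | i. i < dim_row q} \<union>
     {free_gen (T j) * free_gen (T i)
        - Poly_Mapping.single 0 (q $$ (i, j)) * (free_gen (T i) * free_gen (T j))
      | i j. i < dim_row q \<and> j < dim_row q}"

lemma torus_relators_subset:
  "torus_relators q \<subseteq> carrier (free_algebra (torus_letters (dim_row q)))"
proof -
  let ?X = "torus_letters (dim_row q)"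
  interpret ring "free_algebra ?X :: ('a, torus_letter word \<Rightarrow>\<^sub>0 'a) module"
    by (rule ring_free_algebra)
  let ?C = "carrier (free_algebra ?X :: ('a, torus_letter word \<Rightarrow>\<^sub>0 'a) module)"
  have gen: "free_gen x \<in> ?C" if "x \<in> ?X" for x
    using that by (auto simp: free_algebra_def free_gen_def)
  have const: "Poly_Mapping.single 0 c \<in> ?C" for c
    by (auto simp: free_algebra_def zero_word_def)
  have one: "1 \<in> ?C" using one_closed by (simp add: free_algebra_def)
  have mult: "f * g \<in> ?C" if "f \<in> ?C" "g \<in> ?C" for f g
    using m_closed[OF that] by (simp add: free_algebra_def)
  have diff: "f - g \<in> ?C" if "f \<in> ?C" "g \<in> ?C" for f g
    using that keys_diff[of f g] by (auto simp: free_algebra_def)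
  show ?thesis
  proof
    have T: "free_gen (T i) \<in> ?C" "free_gen (Tinv i) \<in> ?C" if "i < dim_row q" for i
      by (rule gen; use that in \<open>simp add: torus_letters_def\<close>)+
    fix r assume "r \<in> torus_relators q"
    then show "r \<in> ?C"
      by (auto simp: torus_relators_def intro!: diff mult one const T)
  qed
qed

type_synonym 'a torus_element = "(torus_letter word \<Rightarrow>\<^sub>0 'a) set"

definition quantum_torus :: "'a::field mat \<Rightarrow> ('a, 'a torus_element) module" where
  "quantum_torus q = presented_algebra (torus_letters (dim_row q)) (torus_relators q)"

definition torus_gen :: "'a::field mat \<Rightarrow> nat \<Rightarrow> 'a torus_element" where
  "torus_gen q i = presented_gen (torus_letters (dim_row q)) (torus_relators q) (T i)"

definition torus_monomial :: "'a::field mat \<Rightarrow> (nat \<Rightarrow>\<^sub>0 int) \<Rightarrow> 'a torus_element" where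
  "torus_monomial q \<alpha> =
     foldr (\<otimes>\<^bsub>quantum_torus q\<^esub>)
       (map (\<lambda>i. torus_gen q i [^]\<^bsub>quantum_torus q\<^esub> Poly_Mapping.lookup \<alpha> i) [0..<dim_row q])
       \<one>\<^bsub>quantum_torus q\<^esub>"

section \<open>Toral gradings\<close>

abbreviation lattice :: "nat \<Rightarrow> (nat \<Rightarrow>\<^sub>0 int) monoid" where
  "lattice n \<equiv> free_Abelian_group {..<n}"

text \<open>\<open>frag_extend \<sigma> \<alpha>\<close> is the integer combination of the \<open>\<sigma> i\<close> with coefficients \<open>\<alpha>\<close>.\<close>

definition lattice_basis :: "nat \<Rightarrow> (nat \<Rightarrow> (nat \<Rightarrow>\<^sub>0 int)) \<Rightarrow> bool" where
  "lattice_basis n \<sigma> \<longleftrightarrow>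
     (\<forall>i<n. \<sigma> i \<in> carrier (lattice n)) \<and>
     bij_betw (frag_extend \<sigma>) (carrier (lattice n)) (carrier (lattice n))"

text \<open>
  \<open>G d\<close> is the homogeneous component of degree \<open>d\<close>. A toral grading of an algebra \<open>A\<close> comes
  from an identification of \<open>A\<close> with a quantum torus, that is, from a choice of toral
  generators of \<open>A\<close>: for the monomials in one fixed system of generators, whether
  \<open>t\<^sub>\<alpha>\<close> is central depends only on the coordinates \<open>\<alpha>\<close> and not on the basis \<open>\<sigma>\<close>.
\<close>

definition toral_grading ::
  "nat \<Rightarrow> ('a::field, 'b) module \<Rightarrow> (nat \<Rightarrow> (nat \<Rightarrow>\<^sub>0 int)) \<Rightarrow> ((nat \<Rightarrow>\<^sub>0 int) \<Rightarrow> 'b set) \<Rightarrow> bool" where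
  "toral_grading n A \<sigma> G \<longleftrightarrow>
     lattice_basis n \<sigma> \<and>
     (\<exists>q. quantum_matrix n q \<and>
       (\<exists>\<phi> \<in> algebra_isos (quantum_torus q) A.
          \<forall>\<alpha> \<in> carrier (lattice n).
            G (frag_extend \<sigma> \<alpha>) = range (\<lambda>c. c \<odot>\<^bsub>A\<^esub> \<phi> (torus_monomial q \<alpha>))))"

definition centre_grading_group ::
  "nat \<Rightarrow> ('a, 'b) module \<Rightarrow> ((nat \<Rightarrow>\<^sub>0 int) \<Rightarrow> 'b set) \<Rightarrow> (nat \<Rightarrow>\<^sub>0 int) set" where
  "centre_grading_group n A G =
     {d \<in> carrier (lattice n). \<exists>z \<in> centre A \<inter> G d. z \<noteq> \<zero>\<^bsub>A\<^esub>}"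

end

theory Submission
  imports Defs "HOL-Library.Function_Algebras"
begin

text \<open>
  Write the entries of an elementary quantum matrix as \<open>(-1)\<^bsup>b(i,j)\<^esup>\<close>. Then \<open>b\<close> is an alternating form
  over the field of two elements, and the torus depends only on this form. Replacing \<open>t\<^sub>j\<close> by
  \<open>t\<^sub>j t\<^sub>i\<close> is an invertible change of toral generators whose effect on \<open>b\<close> is a transvection
  (\<open>transvect_isomorphic\<close>). Symplectic Gaussian elimination by transvections turns \<open>b\<close> into an
  orthogonal sum of \<open>l\<close> hyperbolic planes and a zero form (\<open>hyperbolic_form_reached\<close>), which is the
  form of \<open>h\<^bsub>l,n\<^esub>\<close> (\<open>h_mat_eq_sign_mat\<close>). This gives the isomorphism.

  For the centre, take the toral grading by the generators of the torus in normal form, with the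
  standard basis of the lattice. A monomial \<open>t\<^sub>\<alpha>\<close> commutes with each generator up to a sign given by
  the form at \<open>\<alpha>\<close>, and since \<open>2 \<noteq> 0\<close> it is central exactly when \<open>\<alpha>\<close> modulo two lies in the radical
  (\<open>torus_monomial_central_iff\<close>), that is, when the first \<open>2 l\<close> coordinates are even.

  For the invariance of \<open>l\<close>, the point is that \<open>2 ^ l\<close> is the least degree of a matrix representation of
  the torus in normal form over the ground field. Pauli matrices give a representation of this degree
  (\<open>h_torus_matrix_representation\<close>). Conversely, in any representation the images of the square-free
  monomials in the first \<open>2 l\<close> generators are eigenvectors of conjugation with different systems of
  eigenvalues, so these \<open>4 ^ l\<close> matrices are linearly independent and the degree \<open>N\<close> satisfies
  \<open>4 ^ l \<le> N\<^sup>2\<close> (\<open>h_torus_representation_bound\<close>).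

  Homomorphisms out of a torus come from the universal property of algebras given by generators and
  relations (\<open>presented_algebra_universal\<close>).
\<close>

section \<open>Unital algebras and their homomorphisms\<close>

locale unital_algebra = ring A for A :: "('a::field, 'b) module" (structure) +
  assumes smult_closed [simp, intro]: "x \<in> carrier A \<Longrightarrow> c \<odot> x \<in> carrier A"
    and smult_l_distr: "x \<in> carrier A \<Longrightarrow> (c + d) \<odot> x = c \<odot> x \<oplus> d \<odot> x"
    and smult_r_distr: "x \<in> carrier A \<Longrightarrow> y \<in> carrier A \<Longrightarrow> c \<odot> (x \<oplus> y) = c \<odot> x \<oplus> c \<odot> y"
    and smult_smult: "x \<in> carrier A \<Longrightarrow> c \<odot> (d \<odot> x) = (c * d) \<odot> x"
    and smult_one [simp]: "x \<in> carrier A \<Longrightarrow> 1 \<odot> x = x"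
    and smult_mult_left: "x \<in> carrier A \<Longrightarrow> y \<in> carrier A \<Longrightarrow> (c \<odot> x) \<otimes> y = c \<odot> (x \<otimes> y)"
    and smult_mult_right: "x \<in> carrier A \<Longrightarrow> y \<in> carrier A \<Longrightarrow> x \<otimes> (c \<odot> y) = c \<odot> (x \<otimes> y)"
begin

lemma smult_zero_left [simp]:
  assumes x: "x \<in> carrier A"
  shows "0 \<odot> x = \<zero>"
proof -
  have "0 \<odot> x \<oplus> 0 \<odot> x = 0 \<odot> x" using smult_l_distr[OF x, of 0 0] by simp
  then show ?thesis using x by (metis add.l_cancel_one' smult_closed)
qed

lemma smult_zero_right [simp]: "c \<odot> \<zero> = \<zero>"
  using smult_mult_left[of \<one> \<zero> c] by simp

lemma smult_minus_one:
  assumes x: "x \<in> carrier A"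
  shows "(- 1) \<odot> x = \<ominus> x"
proof -
  have "(- 1) \<odot> x \<oplus> x = \<zero>" using smult_l_distr[OF x, of "- 1" 1] x by simp
  then show ?thesis using x by (metis minus_equality smult_closed)
qed

end

definition algebra_hom :: "('a, 'b) module \<Rightarrow> ('a, 'c) module \<Rightarrow> ('b \<Rightarrow> 'c) set" where
  "algebra_hom A B =
     {\<phi> \<in> Ring.ring_hom A B. \<forall>c. \<forall>x\<in>carrier A. \<phi> (c \<odot>\<^bsub>A\<^esub> x) = c \<odot>\<^bsub>B\<^esub> \<phi> x}"

lemma algebra_homI:
  assumes "\<And>x. x \<in> carrier A \<Longrightarrow> \<phi> x \<in> carrier B"
    and "\<And>x y. x \<in> carrier A \<Longrightarrow> y \<in> carrier A \<Longrightarrow> \<phi> (x \<otimes>\<^bsub>A\<^esub> y) = \<phi> x \<otimes>\<^bsub>B\<^esub> \<phi> y"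
    and "\<And>x y. x \<in> carrier A \<Longrightarrow> y \<in> carrier A \<Longrightarrow> \<phi> (x \<oplus>\<^bsub>A\<^esub> y) = \<phi> x \<oplus>\<^bsub>B\<^esub> \<phi> y"
    and "\<phi> \<one>\<^bsub>A\<^esub> = \<one>\<^bsub>B\<^esub>"
    and "\<And>c x. x \<in> carrier A \<Longrightarrow> \<phi> (c \<odot>\<^bsub>A\<^esub> x) = c \<odot>\<^bsub>B\<^esub> \<phi> x"
  shows "\<phi> \<in> algebra_hom A B"
  using assms by (auto simp: algebra_hom_def intro!: ring_hom_memI)

lemma algebra_homD:
  assumes "\<phi> \<in> algebra_hom A B"
  shows "\<And>x. x \<in> carrier A \<Longrightarrow> \<phi> x \<in> carrier B"
    and "\<And>x y. x \<in> carrier A \<Longrightarrow> y \<in> carrier A \<Longrightarrow> \<phi> (x \<otimes>\<^bsub>A\<^esub> y) = \<phi> x \<otimes>\<^bsub>B\<^esub> \<phi> y"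
    and "\<And>x y. x \<in> carrier A \<Longrightarrow> y \<in> carrier A \<Longrightarrow> \<phi> (x \<oplus>\<^bsub>A\<^esub> y) = \<phi> x \<oplus>\<^bsub>B\<^esub> \<phi> y"
    and "\<phi> \<one>\<^bsub>A\<^esub> = \<one>\<^bsub>B\<^esub>"
    and "\<And>c x. x \<in> carrier A \<Longrightarrow> \<phi> (c \<odot>\<^bsub>A\<^esub> x) = c \<odot>\<^bsub>B\<^esub> \<phi> x"
  using assms by (auto simp: algebra_hom_def ring_hom_memE)

lemma algebra_hom_comp:
  assumes "\<phi> \<in> algebra_hom A B" "\<psi> \<in> algebra_hom B C"
  shows "\<psi> \<circ> \<phi> \<in> algebra_hom A C"
  using algebra_homD[OF assms(1)] algebra_homD[OF assms(2)] by (intro algebra_homI) auto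

lemma algebra_isos_iff: "\<phi> \<in> algebra_isos A B \<longleftrightarrow> \<phi> \<in> algebra_hom A B \<and> bij_betw \<phi> (carrier A) (carrier B)"
  by (auto simp: algebra_isos_def algebra_hom_def ring_iso_def)

lemma algebra_isos_comp:
  assumes "\<phi> \<in> algebra_isos A B" "\<psi> \<in> algebra_isos B C"
  shows "\<psi> \<circ> \<phi> \<in> algebra_isos A C"
  using assms algebra_hom_comp bij_betw_trans unfolding algebra_isos_iff by blast

lemma (in unital_algebra) algebra_isos_inv:
  assumes \<phi>: "\<phi> \<in> algebra_isos A B"
  shows "inv_into (carrier A) \<phi> \<in> algebra_isos B A"
proof -
  let ?\<psi> = "inv_into (carrier A) \<phi>"
  have hom: "\<phi> \<in> algebra_hom A B" and bij: "bij_betw \<phi> (carrier A) (carrier B)"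
    using \<phi> by (auto simp: algebra_isos_iff)
  note h = algebra_homD[OF hom]
  have inj: "inj_on \<phi> (carrier A)" using bij by (simp add: bij_betw_def)
  have c: "?\<psi> y \<in> carrier A" "\<phi> (?\<psi> y) = y" if "y \<in> carrier B" for y
    using that bij by (auto simp: bij_betw_def inv_into_into f_inv_into_f)
  have eq: "?\<psi> y = x" if "x \<in> carrier A" "\<phi> x = y" for x y
    using that inj by auto
  have "?\<psi> \<in> algebra_hom B A"
    by (rule algebra_homI) (auto simp: c h intro!: eq)
  then show ?thesis
    using bij bij_betw_inv_into by (auto simp: algebra_isos_iff)
qed

lemma algebra_isos_of_inverse_homs:
  assumes \<phi>: "\<phi> \<in> algebra_hom A B" and \<psi>: "\<psi> \<in> algebra_hom B A"
    and "\<And>x. x \<in> carrier A \<Longrightarrow> \<psi> (\<phi> x) = x"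
    and "\<And>y. y \<in> carrier B \<Longrightarrow> \<phi> (\<psi> y) = y"
  shows "\<phi> \<in> algebra_isos A B"
  unfolding algebra_isos_iff
  using assms algebra_homD(1)[OF \<phi>] algebra_homD(1)[OF \<psi>]
  by (auto intro!: bij_betw_byWitness[where f' = \<psi>])

lemma algebra_isomorphic_refl: "algebra_isomorphic A A"
  unfolding algebra_isomorphic_def algebra_isos_def using ring_iso_set_refl by fastforce

lemma algebra_isomorphic_trans:
  "algebra_isomorphic A B \<Longrightarrow> algebra_isomorphic B C \<Longrightarrow> algebra_isomorphic A C"
  unfolding algebra_isomorphic_def using algebra_isos_comp by blast

lemma (in unital_algebra) algebra_isomorphic_sym: "algebra_isomorphic A B \<Longrightarrow> algebra_isomorphic B A"
  unfolding algebra_isomorphic_def using algebra_isos_inv by blast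

section \<open>The universal property of presented algebras\<close>

lemma single_induct [case_names single add]:
  assumes "\<And>k c. P (Poly_Mapping.single k c)" and "\<And>f g. P f \<Longrightarrow> P g \<Longrightarrow> P (f + g)"
  shows "P (f :: 'k \<Rightarrow>\<^sub>0 'c::comm_monoid_add)"
proof -
  have sum: "P (\<Sum>k\<in>S. Poly_Mapping.single k (Poly_Mapping.lookup f k))" if "finite S" for S
    using that by (induction S) (use assms(1)[of undefined 0] in \<open>auto intro: assms\<close>)
  have "f = (\<Sum>k\<in>Poly_Mapping.keys f. Poly_Mapping.single k (Poly_Mapping.lookup f k))"
    by (rule poly_mapping_eqI) (auto simp: lookup_sum lookup_single when_def in_keys_iff)
  with sum[of "Poly_Mapping.keys f"] show ?thesis by simp
qed

lemma scalar_commute: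
  "Poly_Mapping.single 0 c * f = f * Poly_Mapping.single 0 c"
  for f :: "'k::monoid_add \<Rightarrow>\<^sub>0 'c::comm_semiring_0"
  by (induction f rule: single_induct) (simp_all add: mult_single mult.commute algebra_simps)

lemma free_algebra_simps:
  "f \<otimes>\<^bsub>free_algebra X\<^esub> g = f * g" "f \<oplus>\<^bsub>free_algebra X\<^esub> g = f + g"
  "\<zero>\<^bsub>free_algebra X\<^esub> = 0" "\<one>\<^bsub>free_algebra X\<^esub> = 1"
  "c \<odot>\<^bsub>free_algebra X\<^esub> f = Poly_Mapping.single 0 c * f"
  by (simp_all add: free_algebra_def)

lemma unital_algebra_free: "unital_algebra (free_algebra X :: ('a::field, 'x word \<Rightarrow>\<^sub>0 'a) module)"
proof -
  let ?A = "free_algebra X :: ('a, 'x word \<Rightarrow>\<^sub>0 'a) module"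
  interpret ring ?A by (rule ring_free_algebra)
  have const: "Poly_Mapping.single 0 c \<in> carrier ?A" for c
    by (auto simp: free_algebra_def zero_word_def)
  show ?thesis
  proof
    show "c \<odot>\<^bsub>?A\<^esub> x \<in> carrier ?A" if "x \<in> carrier ?A" for c x
      using m_closed[OF const that] by (simp add: free_algebra_simps)
    show "x \<otimes>\<^bsub>?A\<^esub> (c \<odot>\<^bsub>?A\<^esub> y) = c \<odot>\<^bsub>?A\<^esub> (x \<otimes>\<^bsub>?A\<^esub> y)" for c x y
      by (metis free_algebra_simps(1,5) mult.assoc scalar_commute)
  qed (simp_all add: free_algebra_simps single_add distrib_left distrib_right mult_single flip: mult.assoc)
qed

definition word_value :: "('a, 'b) module \<Rightarrow> ('x \<Rightarrow> 'b) \<Rightarrow> 'x word \<Rightarrow> 'b" where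
  "word_value B v w = foldr (\<lambda>x y. v x \<otimes>\<^bsub>B\<^esub> y) (letters w) \<one>\<^bsub>B\<^esub>"

definition evaluate :: "('a, 'b) module \<Rightarrow> ('x \<Rightarrow> 'b) \<Rightarrow> ('x word \<Rightarrow>\<^sub>0 'a::field) \<Rightarrow> 'b" where
  "evaluate B v f =
     (\<Oplus>\<^bsub>B\<^esub>w\<in>Poly_Mapping.keys f. Poly_Mapping.lookup f w \<odot>\<^bsub>B\<^esub> word_value B v w)"

context unital_algebra
begin

context
  fixes v :: "'x \<Rightarrow> 'b"
  assumes v [simp]: "v x \<in> carrier A"
begin

lemma word_value_closed [simp]: "word_value A v w \<in> carrier A"
proof -
  have "foldr (\<lambda>x y. v x \<otimes> y) xs \<one> \<in> carrier A" for xs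
    by (induction xs) auto
  then show ?thesis by (simp add: word_value_def)
qed

lemma word_value_plus: "word_value A v (w + w') = word_value A v w \<otimes> word_value A v w'"
proof -
  have cl: "foldr (\<lambda>x y. v x \<otimes> y) xs \<one> \<in> carrier A" for xs
    by (induction xs) auto
  have "foldr (\<lambda>x y. v x \<otimes> y) (xs @ ys) \<one>
      = foldr (\<lambda>x y. v x \<otimes> y) xs \<one> \<otimes> foldr (\<lambda>x y. v x \<otimes> y) ys \<one>" for xs ys
    by (induction xs) (use cl in \<open>auto simp: m_assoc\<close>)
  then show ?thesis by (simp add: word_value_def plus_word_def)
qed

text \<open>
  Summing over any finite superset of the support brings two elements to a common index set, so
  that their evaluations can be added termwise.
\<close>

lemma evaluate_superset:
  assumes "finite S" "Poly_Mapping.keys f \<subseteq> S"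
  shows "evaluate A v f = (\<Oplus>w\<in>S. Poly_Mapping.lookup f w \<odot> word_value A v w)"
  unfolding evaluate_def using assms
  by (intro add.finprod_mono_neutral_cong_left) (auto simp: in_keys_iff)

lemma evaluate_closed [simp]: "evaluate A v f \<in> carrier A"
  unfolding evaluate_def by (intro finsum_closed) auto

lemma evaluate_add: "evaluate A v (f + g) = evaluate A v f \<oplus> evaluate A v g"
proof -
  let ?S = "Poly_Mapping.keys f \<union> Poly_Mapping.keys g"
  have "evaluate A v (f + g) = (\<Oplus>w\<in>?S. Poly_Mapping.lookup (f + g) w \<odot> word_value A v w)"
    by (rule evaluate_superset) (use Poly_Mapping.keys_add[of f g] in auto)
  also have "\<dots> = (\<Oplus>w\<in>?S. Poly_Mapping.lookup f w \<odot> word_value A v w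
                     \<oplus> Poly_Mapping.lookup g w \<odot> word_value A v w)"
    by (intro finsum_cong') (auto simp: lookup_add smult_l_distr)
  also have "\<dots> = evaluate A v f \<oplus> evaluate A v g"
    by (subst finsum_addf) (auto simp: evaluate_superset[of ?S])
  finally show ?thesis .
qed

lemma evaluate_single [simp]: "evaluate A v (Poly_Mapping.single w c) = c \<odot> word_value A v w"
  by (subst evaluate_superset[of "{w}"]) (auto split: if_splits)

lemma evaluate_one: "evaluate A v 1 = \<one>"
  by (simp add: word_value_def zero_word_def flip: single_one)

lemma evaluate_mult: "evaluate A v (f * g) = evaluate A v f \<otimes> evaluate A v g"
proof (induction f rule: single_induct)
  case (single w c)
  show ?case
    by (induction g rule: single_induct)
      (simp_all add: mult_single word_value_plus smult_mult_left smult_mult_right smult_smult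
        distrib_left evaluate_add r_distr mult.commute)
qed (simp_all add: distrib_right evaluate_add l_distr)

lemma evaluate_scalar: "evaluate A v (Poly_Mapping.single 0 c * f) = c \<odot> evaluate A v f"
  using smult_mult_left[of \<one> "evaluate A v f" c]
  by (simp add: evaluate_mult word_value_def zero_word_def)

lemma evaluate_diff: "evaluate A v (f - g) = evaluate A v f \<ominus> evaluate A v g"
proof -
  have "evaluate A v (f - g) \<oplus> evaluate A v g = evaluate A v f"
    by (simp flip: evaluate_add)
  then show ?thesis
    by (metis evaluate_closed a_minus_def add.inv_solve_right')
qed

lemma evaluate_gen [simp]: "evaluate A v (free_gen x) = v x"
  by (simp add: free_gen_def word_value_def)

lemma evaluate_hom: "evaluate A v \<in> algebra_hom (free_algebra X) A"
proof (rule algebra_homI)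
  show "evaluate A v (c \<odot>\<^bsub>free_algebra X\<^esub> f) = c \<odot> evaluate A v f" for c f
    unfolding free_algebra_simps by (rule evaluate_scalar)
qed (simp_all add: free_algebra_simps evaluate_add evaluate_mult evaluate_one)

end

end

lemma quotient_algebra_simps:
  "carrier (quotient_algebra A I) = a_rcosets\<^bsub>A\<^esub> I"
  "X \<otimes>\<^bsub>quotient_algebra A I\<^esub> Y = rcoset_mult A I X Y"
  "X \<oplus>\<^bsub>quotient_algebra A I\<^esub> Y = X <+>\<^bsub>A\<^esub> Y"
  "\<zero>\<^bsub>quotient_algebra A I\<^esub> = I" "\<one>\<^bsub>quotient_algebra A I\<^esub> = I +>\<^bsub>A\<^esub> \<one>\<^bsub>A\<^esub>"
  "c \<odot>\<^bsub>quotient_algebra A I\<^esub> X = (\<Union>x\<in>X. I +>\<^bsub>A\<^esub> (c \<odot>\<^bsub>A\<^esub> x))"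
  by (simp_all add: quotient_algebra_def FactRing_def ring.defs module.defs)

context unital_algebra
begin

context
  fixes I
  assumes I: "ideal I A"
begin

interpretation ideal I A by (rule I)

lemma carrier_quotient_algebra: "carrier (quotient_algebra A I) = (\<lambda>a. I +> a) ` carrier A"
  by (auto simp: quotient_algebra_simps A_RCOSETS_def')

text \<open>
  An ideal is closed under scalars because \<open>c \<odot> i = (c \<odot> \<one>) \<otimes> i\<close>; hence the union that defines
  the scalar multiple of a coset is a union of equal cosets.
\<close>

lemma smult_coset:
  assumes x: "x \<in> carrier A"
  shows "c \<odot>\<^bsub>quotient_algebra A I\<^esub> (I +> x) = I +> (c \<odot> x)"
proof -
  have "I +> (c \<odot> y) = I +> (c \<odot> x)" if "y \<in> I +> x" for y
  proof -
    obtain i where i: "i \<in> I" "y = i \<oplus> x" using \<open>y \<in> I +> x\<close> by (auto simp: a_r_coset_def')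
    have iA: "i \<in> carrier A" using i by auto
    have "c \<odot> i = (c \<odot> \<one>) \<otimes> i" using iA by (simp add: smult_mult_left)
    then have "c \<odot> i \<in> I" using i I_l_closed by simp
    moreover have "c \<odot> y = c \<odot> i \<oplus> c \<odot> x" using i iA x by (simp add: smult_r_distr)
    ultimately have "c \<odot> y \<in> I +> (c \<odot> x)" by (auto simp: a_r_coset_def')
    then show ?thesis using x a_repr_independence' by (metis smult_closed)
  qed
  moreover have "x \<in> I +> x" using x by (rule a_rcos_self)
  ultimately show ?thesis unfolding quotient_algebra_simps by blast
qed

lemma coset_hom: "(+>) I \<in> algebra_hom A (quotient_algebra A I)"
  by (rule algebra_homI)
    (auto simp: carrier_quotient_algebra smult_coset rcoset_mult_add a_rcos_sum
      quotient_algebra_simps(2-5))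

lemma unital_algebra_quotient: "unital_algebra (quotient_algebra A I)"
proof -
  let ?Q = "quotient_algebra A I"
  interpret F: ring "A Quot I" by (rule quotient_is_ring)
  have eq: "carrier ?Q = carrier (A Quot I)" "monoid.mult ?Q = monoid.mult (A Quot I)" "ring.add ?Q = ring.add (A Quot I)"
    "\<zero>\<^bsub>?Q\<^esub> = \<zero>\<^bsub>A Quot I\<^esub>" "\<one>\<^bsub>?Q\<^esub> = \<one>\<^bsub>A Quot I\<^esub>"
    by (simp_all add: quotient_algebra_def ring.defs module.defs)
  have "ring ?Q"
  proof (rule ringI, goal_cases)
    case 1
    show ?case
      by (rule abelian_groupI; unfold eq)
        (auto simp: F.a_ac intro: F.l_neg)
  next
    case 2
    show ?case by (rule monoidI; unfold eq) (auto simp: F.m_assoc)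
  qed (auto simp: eq F.l_distr F.r_distr)
  then interpret Q: ring ?Q .
  note [simp] = carrier_quotient_algebra
  note h = algebra_homD(2-5)[OF coset_hom, symmetric]
  show ?thesis
    by unfold_locales
      (auto simp: h smult_l_distr smult_r_distr smult_smult smult_mult_left smult_mult_right)
qed

lemma quotient_algebra_lift:
  assumes f: "f \<in> algebra_hom A B" and B: "unital_algebra B"
    and 0: "\<And>i. i \<in> I \<Longrightarrow> f i = \<zero>\<^bsub>B\<^esub>"
  obtains g where "g \<in> algebra_hom (quotient_algebra A I) B"
    "\<And>a. a \<in> carrier A \<Longrightarrow> g (I +> a) = f a"
proof -
  interpret B: unital_algebra B by (rule B)
  note h = algebra_homD[OF f]
  have "f b = f a" if "a \<in> carrier A" "b \<in> I +> a" for a b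
    using that 0 h by (auto simp: a_r_coset_def')
  moreover have "a \<in> I +> a" if "a \<in> carrier A" for a using that by (rule a_rcos_self)
  ultimately have eq: "the_elem (f ` (I +> a)) = f a" if "a \<in> carrier A" for a
    using that by (intro the_elem_image_unique) blast+
  note q = algebra_homD(2-5)[OF coset_hom, symmetric]
  have "(\<lambda>X. the_elem (f ` X)) \<in> algebra_hom (quotient_algebra A I) B"
    by (rule algebra_homI) (auto simp: carrier_quotient_algebra q eq h)
  with eq show ?thesis using that by blast
qed

end

end

context
  fixes X :: "'x set" and R :: "('x word \<Rightarrow>\<^sub>0 'a::field) set"
  assumes R: "R \<subseteq> carrier (free_algebra X)"
begin

interpretation free: unital_algebra "free_algebra X :: ('a, 'x word \<Rightarrow>\<^sub>0 'a) module"
  by (rule unital_algebra_free)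

lemma ideal_relators: "ideal (Idl\<^bsub>free_algebra X\<^esub> R) (free_algebra X)"
  by (rule free.genideal_ideal[OF R])

lemma unital_algebra_presented: "unital_algebra (presented_algebra X R)"
  unfolding presented_algebra_def by (rule free.unital_algebra_quotient[OF ideal_relators])

lemma coset_hom_presented: "(+>\<^bsub>free_algebra X\<^esub>) (Idl\<^bsub>free_algebra X\<^esub> R) \<in> algebra_hom (free_algebra X) (presented_algebra X R)"
  unfolding presented_algebra_def by (rule free.coset_hom[OF ideal_relators])

lemma coset_relator:
  assumes "r \<in> R"
  shows "Idl\<^bsub>free_algebra X\<^esub> R +>\<^bsub>free_algebra X\<^esub> r = \<zero>\<^bsub>presented_algebra X R\<^esub>"
proof -
  interpret ideal "Idl\<^bsub>free_algebra X\<^esub> R" "free_algebra X" by (rule ideal_relators)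
  have "r \<in> Idl\<^bsub>free_algebra X\<^esub> R" using assms free.genideal_self[OF R] by blast
  then show ?thesis
    by (simp add: presented_algebra_def quotient_algebra_simps a_rcos_const)
qed

lemma free_gen_closed: "x \<in> X \<Longrightarrow> free_gen x \<in> carrier (free_algebra X :: ('a, 'x word \<Rightarrow>\<^sub>0 'a) module)"
  by (auto simp: free_algebra_def free_gen_def)

text \<open>
  Every element is a linear combination of products of generators, so a property that survives
  the algebra operations only has to be checked on the generators.
\<close>

lemma presented_algebra_induct [consumes 1, case_names one gen add mult smult]:
  assumes z: "z \<in> carrier (presented_algebra X R)"
    and one: "P \<one>\<^bsub>presented_algebra X R\<^esub>"
    and gen: "\<And>x. x \<in> X \<Longrightarrow> P (presented_gen X R x)"
    and add: "\<And>y z. y \<in> carrier (presented_algebra X R) \<Longrightarrow> z \<in> carrier (presented_algebra X R)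
        \<Longrightarrow> P y \<Longrightarrow> P z \<Longrightarrow> P (y \<oplus>\<^bsub>presented_algebra X R\<^esub> z)"
    and mult: "\<And>y z. y \<in> carrier (presented_algebra X R) \<Longrightarrow> z \<in> carrier (presented_algebra X R)
        \<Longrightarrow> P y \<Longrightarrow> P z \<Longrightarrow> P (y \<otimes>\<^bsub>presented_algebra X R\<^esub> z)"
    and smult: "\<And>c z. z \<in> carrier (presented_algebra X R)
        \<Longrightarrow> P z \<Longrightarrow> P (c \<odot>\<^bsub>presented_algebra X R\<^esub> z)"
  shows "P z"
proof -
  let ?A = "free_algebra X :: ('a, 'x word \<Rightarrow>\<^sub>0 'a) module"
  let ?\<pi> = "\<lambda>f. Idl\<^bsub>?A\<^esub> R +>\<^bsub>?A\<^esub> f"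
  interpret presented: unital_algebra "presented_algebra X R" by (rule unital_algebra_presented)
  note \<pi> = algebra_homD[OF coset_hom_presented]
  obtain f where f: "f \<in> carrier ?A" "z = ?\<pi> f"
    using z free.carrier_quotient_algebra[OF ideal_relators] by (auto simp: presented_algebra_def)
  have word: "Poly_Mapping.single w 1 \<in> carrier ?A \<and> P (?\<pi> (Poly_Mapping.single w 1))"
    if "set (letters w) \<subseteq> X" for w
    using that
  proof (induction "letters w" arbitrary: w)
    case Nil
    then have "Poly_Mapping.single w (1::'a) = \<one>\<^bsub>?A\<^esub>"
      by (cases w) (simp add: free_algebra_simps zero_word_def flip: single_one)
    then show ?case using one \<pi>(4) free.one_closed by simp
  next
    case (Cons x xs)
    have w: "Poly_Mapping.single w (1::'a) = free_gen x \<otimes>\<^bsub>?A\<^esub> Poly_Mapping.single (Word xs) 1"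
      using Cons(2) by (cases w) (simp add: free_algebra_simps free_gen_def mult_single plus_word_def)
    have "P (presented_gen X R x)" "free_gen x \<in> carrier ?A"
      using Cons.hyps(2)[symmetric] Cons.prems gen free_gen_closed by auto
    then show ?case
      unfolding w using Cons.hyps(1)[of "Word xs"] Cons.hyps(2)[symmetric] Cons.prems
      by (auto simp: \<pi> presented_gen_def intro!: mult)
  qed
  have single: "Poly_Mapping.single w c = c \<odot>\<^bsub>?A\<^esub> Poly_Mapping.single w 1" for w and c :: 'a
    by (simp add: free_algebra_simps mult_single)
  have "(\<Sum>w\<in>S. Poly_Mapping.single w (Poly_Mapping.lookup f w)) \<in> carrier ?A
      \<and> P (?\<pi> (\<Sum>w\<in>S. Poly_Mapping.single w (Poly_Mapping.lookup f w)))"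
    if "finite S" "S \<subseteq> Poly_Mapping.keys f" for S
    using that
  proof (induction S)
    case empty
    have "?\<pi> 0 = 0 \<odot>\<^bsub>presented_algebra X R\<^esub> \<one>\<^bsub>presented_algebra X R\<^esub>"
      using \<pi>(5)[OF free.one_closed, of 0] unfolding \<pi>(4) by (simp add: free_algebra_simps)
    then show ?case
      using one smult[of "\<one>\<^bsub>presented_algebra X R\<^esub>" 0] free.zero_closed
      by (simp add: free_algebra_simps(3))
  next
    case (insert w S)
    have w: "set (letters w) \<subseteq> X" using insert f by (auto simp: free_algebra_def)
    let ?s = "Poly_Mapping.single w (Poly_Mapping.lookup f w)"
    have s: "?s \<in> carrier ?A" "P (?\<pi> ?s)"
      unfolding single[of w "Poly_Mapping.lookup f w"] using word[OF w] by (auto simp: \<pi> intro!: smult)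
    show ?case using insert s add[OF \<pi>(1,1), of ?s] \<pi>(3)[of ?s] free.a_closed[of ?s]
      by (simp add: free_algebra_simps)
  qed
  moreover have "f = (\<Sum>k\<in>Poly_Mapping.keys f. Poly_Mapping.single k (Poly_Mapping.lookup f k))"
    by (rule poly_mapping_eqI) (auto simp: lookup_sum lookup_single when_def in_keys_iff)
  ultimately show ?thesis unfolding f(2) by (metis finite_keys order_refl)
qed

text \<open>
  Evaluation on the free algebra kills the relators. Its kernel is an ideal, so it contains the
  ideal that they generate, and evaluation descends to the quotient. The assignment \<open>v\<close> takes values
  in \<open>B\<close> on every letter, also outside \<open>X\<close>; this makes evaluation defined on all words.
\<close>

lemma presented_algebra_universal:
  assumes B: "unital_algebra B"
    and v: "\<And>x. v x \<in> carrier B"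
    and rel: "\<And>r. r \<in> R \<Longrightarrow> evaluate B v r = \<zero>\<^bsub>B\<^esub>"
  obtains g where "g \<in> algebra_hom (presented_algebra X R) B"
    "\<And>x. x \<in> X \<Longrightarrow> g (presented_gen X R x) = v x"
proof -
  interpret B: unital_algebra B by (rule B)
  have hom: "evaluate B v \<in> algebra_hom (free_algebra X) B" by (rule B.evaluate_hom[OF v])
  have "evaluate B v \<in> Ring.ring_hom (free_algebra X) B"
    using hom by (simp only: algebra_hom_def mem_Collect_eq)
  then have rh: "ring_hom_ring (free_algebra X) B (evaluate B v)"
    by (rule ring_hom_ringI2[OF free.ring_axioms B.ring_axioms])
  have "R \<subseteq> a_kernel (free_algebra X) B (evaluate B v)"
    using R rel unfolding a_kernel_def' by blast
  then have "Idl\<^bsub>free_algebra X\<^esub> R \<subseteq> a_kernel (free_algebra X) B (evaluate B v)"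
    by (intro free.genideal_minimal ring_hom_ring.kernel_is_ideal[OF rh])
  then have "evaluate B v i = \<zero>\<^bsub>B\<^esub>" if "i \<in> Idl\<^bsub>free_algebra X\<^esub> R" for i
    using that unfolding a_kernel_def' by blast
  from free.quotient_algebra_lift[OF ideal_relators hom B this] obtain g where
    g: "g \<in> algebra_hom (presented_algebra X R) B" and
    coset: "\<And>a. a \<in> carrier (free_algebra X)
      \<Longrightarrow> g (Idl\<^bsub>free_algebra X\<^esub> R +>\<^bsub>free_algebra X\<^esub> a) = evaluate B v a"
    unfolding presented_algebra_def by blast
  have "g (presented_gen X R x) = v x" if "x \<in> X" for x
    unfolding presented_gen_def coset[OF free_gen_closed[OF that]]
    by (rule B.evaluate_gen) (rule v)
  with g show ?thesis by (rule that)
qed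

end

section \<open>Toral generators\<close>

definition torus_inv_gen :: "'a::field mat \<Rightarrow> nat \<Rightarrow> 'a torus_element" where
  "torus_inv_gen q i = presented_gen (torus_letters (dim_row q)) (torus_relators q) (Tinv i)"

lemma torus_letters_iff [simp]:
  "T i \<in> torus_letters n \<longleftrightarrow> i < n" "Tinv i \<in> torus_letters n \<longleftrightarrow> i < n"
  by (auto simp: torus_letters_def)

text \<open>
  A family in \<open>B\<close> that satisfies the defining relations of the quantum torus of \<open>q\<close>. The inverses
  \<open>t'\<close> are part of the data because the torus is presented with separate letters for them.
\<close>

definition toral_system ::
  "('a::field, 'b) module \<Rightarrow> 'a mat \<Rightarrow> (nat \<Rightarrow> 'b) \<Rightarrow> (nat \<Rightarrow> 'b) \<Rightarrow> bool" where
  "toral_system B q t t' \<longleftrightarrow>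
     (\<forall>i<dim_row q. t i \<in> carrier B \<and> t' i \<in> carrier B
        \<and> t i \<otimes>\<^bsub>B\<^esub> t' i = \<one>\<^bsub>B\<^esub> \<and> t' i \<otimes>\<^bsub>B\<^esub> t i = \<one>\<^bsub>B\<^esub>) \<and>
     (\<forall>i<dim_row q. \<forall>j<dim_row q. t j \<otimes>\<^bsub>B\<^esub> t i = q $$ (i, j) \<odot>\<^bsub>B\<^esub> (t i \<otimes>\<^bsub>B\<^esub> t j))"

lemma toral_systemD:
  assumes "toral_system B q t t'" "i < dim_row q"
  shows "t i \<in> carrier B" "t' i \<in> carrier B"
    "t i \<otimes>\<^bsub>B\<^esub> t' i = \<one>\<^bsub>B\<^esub>" "t' i \<otimes>\<^bsub>B\<^esub> t i = \<one>\<^bsub>B\<^esub>"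
    "j < dim_row q \<Longrightarrow> t j \<otimes>\<^bsub>B\<^esub> t i = q $$ (i, j) \<odot>\<^bsub>B\<^esub> (t i \<otimes>\<^bsub>B\<^esub> t j)"
  using assms unfolding toral_system_def by blast+

lemma unital_algebra_quantum_torus: "unital_algebra (quantum_torus q)"
  unfolding quantum_torus_def by (rule unital_algebra_presented[OF torus_relators_subset])

lemma toral_system_torus_gen:
  "toral_system (quantum_torus q) q (torus_gen q) (torus_inv_gen q)" for q :: "'a::field mat"
proof -
  let ?X = "torus_letters (dim_row q)" and ?R = "torus_relators q"
  let ?A = "free_algebra ?X :: ('a, torus_letter word \<Rightarrow>\<^sub>0 'a) module"
  let ?\<pi> = "\<lambda>f. Idl\<^bsub>?A\<^esub> ?R +>\<^bsub>?A\<^esub> f"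
  interpret A: unital_algebra ?A by (rule unital_algebra_free)
  interpret Q: unital_algebra "presented_algebra ?X ?R"
    by (rule unital_algebra_presented[OF torus_relators_subset])
  note R = torus_relators_subset[of q]
  note \<pi> = algebra_homD[OF coset_hom_presented[OF R]]
  have mult: "f * g \<in> carrier ?A" "?\<pi> (f * g) = ?\<pi> f \<otimes>\<^bsub>presented_algebra ?X ?R\<^esub> ?\<pi> g"
    if "f \<in> carrier ?A" "g \<in> carrier ?A" for f g
    using that \<pi>(2) A.m_closed by (simp_all add: free_algebra_simps)
  have smult: "Poly_Mapping.single 0 c * f \<in> carrier ?A"
      "?\<pi> (Poly_Mapping.single 0 c * f) = c \<odot>\<^bsub>presented_algebra ?X ?R\<^esub> ?\<pi> f"
    if "f \<in> carrier ?A" for f c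
    using that \<pi>(5) A.smult_closed by (simp_all add: free_algebra_simps)
  have one: "1 \<in> carrier ?A" "?\<pi> 1 = \<one>\<^bsub>presented_algebra ?X ?R\<^esub>"
    using A.one_closed \<pi>(4) by (simp_all add: free_algebra_simps)
  \<comment> \<open>Elements of the free algebra that differ by a relator have the same class.\<close>
  have eq: "?\<pi> f = ?\<pi> g" if "f - g \<in> ?R" "g \<in> carrier ?A" for f g
  proof -
    have "f - g \<in> carrier ?A" using that R by blast
    then have "?\<pi> ((f - g) + g) = ?\<pi> (f - g) \<oplus>\<^bsub>presented_algebra ?X ?R\<^esub> ?\<pi> g"
      using that \<pi>(3)[of "f - g" g] by (simp add: free_algebra_simps)
    then show ?thesis using that coset_relator[OF R, of "f - g"] \<pi>(1) by simp
  qed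
  have T: "free_gen (T i) \<in> carrier ?A" "free_gen (Tinv i) \<in> carrier ?A" if "i < dim_row q" for i
    using that by (simp_all add: free_gen_closed[OF R])
  note gens = torus_gen_def torus_inv_gen_def presented_gen_def quantum_torus_def
  show ?thesis
    unfolding toral_system_def
  proof (intro conjI allI impI)
    fix i assume i: "i < dim_row q"
    show "torus_gen q i \<in> carrier (quantum_torus q)" "torus_inv_gen q i \<in> carrier (quantum_torus q)"
      using \<pi>(1) T[OF i] by (simp_all add: gens)
    have "free_gen (T i) * free_gen (Tinv i) - 1 \<in> ?R" "free_gen (Tinv i) * free_gen (T i) - 1 \<in> ?R"
      using i by (auto simp: torus_relators_def)
    from this[THEN eq, OF one(1)]
    show "torus_gen q i \<otimes>\<^bsub>quantum_torus q\<^esub> torus_inv_gen q i = \<one>\<^bsub>quantum_torus q\<^esub>"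
      "torus_inv_gen q i \<otimes>\<^bsub>quantum_torus q\<^esub> torus_gen q i = \<one>\<^bsub>quantum_torus q\<^esub>"
      using T[OF i] by (simp_all add: mult one gens)
    fix j assume j: "j < dim_row q"
    have "free_gen (T j) * free_gen (T i)
        - Poly_Mapping.single 0 (q $$ (i, j)) * (free_gen (T i) * free_gen (T j)) \<in> ?R"
      using i j by (auto simp: torus_relators_def)
    from eq[OF this] show "torus_gen q j \<otimes>\<^bsub>quantum_torus q\<^esub> torus_gen q i
        = q $$ (i, j) \<odot>\<^bsub>quantum_torus q\<^esub> (torus_gen q i \<otimes>\<^bsub>quantum_torus q\<^esub> torus_gen q j)"
      using T[OF i] T[OF j] by (simp add: mult smult gens)
  qed
qed

lemma quantum_torus_universal:
  assumes B: "unital_algebra B" and t: "toral_system B q t t'"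
  obtains g where "g \<in> algebra_hom (quantum_torus q) B"
    "\<And>i. i < dim_row q \<Longrightarrow> g (torus_gen q i) = t i"
    "\<And>i. i < dim_row q \<Longrightarrow> g (torus_inv_gen q i) = t' i"
proof -
  interpret B: unital_algebra B by (rule B)
  let ?n = "dim_row q"
  let ?v = "\<lambda>x. case x of T i \<Rightarrow> if i < ?n then t i else \<one>\<^bsub>B\<^esub>
                        | Tinv i \<Rightarrow> if i < ?n then t' i else \<one>\<^bsub>B\<^esub>"
  have v: "?v x \<in> carrier B" for x
    using t by (auto simp: toral_system_def split: torus_letter.split)
  note ev = B.evaluate_diff[of ?v, OF v] B.evaluate_mult[of ?v, OF v] B.evaluate_one[of ?v, OF v]
    B.evaluate_scalar[of ?v, OF v] B.evaluate_gen[of ?v, OF v]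
  have rel: "evaluate B ?v r = \<zero>\<^bsub>B\<^esub>" if "r \<in> torus_relators q" for r
  proof -
    from that consider
      i where "i < ?n" "r = free_gen (T i) * free_gen (Tinv i) - 1"
      | i where "i < ?n" "r = free_gen (Tinv i) * free_gen (T i) - 1"
      | i j where "i < ?n" "j < ?n" "r = free_gen (T j) * free_gen (T i)
            - Poly_Mapping.single 0 (q $$ (i, j)) * (free_gen (T i) * free_gen (T j))"
      unfolding torus_relators_def by blast
    then show ?thesis
    proof cases
      case 1
      then show ?thesis using toral_systemD(1-4)[OF t 1(1)] by (simp add: ev B.r_neg a_minus_def)
    next
      case 2
      then show ?thesis using toral_systemD(1-4)[OF t 2(1)] by (simp add: ev B.r_neg a_minus_def)
    next
      case 3
      then show ?thesis
        using toral_systemD(5)[OF t 3(1,2)] toral_systemD(1)[OF t 3(1)] toral_systemD(1)[OF t 3(2)]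
        unfolding 3(3) ev(1) ev(4) by (simp add: ev(2,5) B.r_neg a_minus_def)
    qed
  qed
  obtain g where g: "g \<in> algebra_hom (quantum_torus q) B"
    "\<And>x. x \<in> torus_letters ?n \<Longrightarrow> g (presented_gen (torus_letters ?n) (torus_relators q) x) = ?v x"
    using presented_algebra_universal[OF torus_relators_subset B v rel]
    unfolding quantum_torus_def by blast
  show ?thesis
    by (rule that[OF g(1)])
      (auto simp: torus_gen_def torus_inv_gen_def g(2))
qed

lemma torus_induct [consumes 1, case_names one gen inv_gen add mult smult]:
  assumes "z \<in> carrier (quantum_torus q)"
    and "P \<one>\<^bsub>quantum_torus q\<^esub>"
    and "\<And>i. i < dim_row q \<Longrightarrow> P (torus_gen q i)"
    and "\<And>i. i < dim_row q \<Longrightarrow> P (torus_inv_gen q i)"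
    and "\<And>y z. y \<in> carrier (quantum_torus q) \<Longrightarrow> z \<in> carrier (quantum_torus q)
        \<Longrightarrow> P y \<Longrightarrow> P z \<Longrightarrow> P (y \<oplus>\<^bsub>quantum_torus q\<^esub> z)"
    and "\<And>y z. y \<in> carrier (quantum_torus q) \<Longrightarrow> z \<in> carrier (quantum_torus q)
        \<Longrightarrow> P y \<Longrightarrow> P z \<Longrightarrow> P (y \<otimes>\<^bsub>quantum_torus q\<^esub> z)"
    and "\<And>c z. z \<in> carrier (quantum_torus q) \<Longrightarrow> P z \<Longrightarrow> P (c \<odot>\<^bsub>quantum_torus q\<^esub> z)"
  shows "P z"
  using assms(1) unfolding quantum_torus_def
proof (induction rule: presented_algebra_induct[OF torus_relators_subset, consumes 1, case_names one gen add mult smult])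
  case (gen x)
  then show ?case
    using assms(3,4) by (auto simp: torus_letters_def torus_gen_def torus_inv_gen_def)
qed (use assms(2,5,6,7) in \<open>simp_all add: quantum_torus_def\<close>)

text \<open>
  Together with the universal property this is how two homomorphisms are recognised as mutually
  inverse: their composites only have to fix the generators.
\<close>

lemma torus_hom_eq:
  assumes \<phi>: "\<phi> \<in> algebra_hom (quantum_torus q) B" and \<psi>: "\<psi> \<in> algebra_hom (quantum_torus q) B"
    and "\<And>i. i < dim_row q \<Longrightarrow> \<phi> (torus_gen q i) = \<psi> (torus_gen q i)"
    and "\<And>i. i < dim_row q \<Longrightarrow> \<phi> (torus_inv_gen q i) = \<psi> (torus_inv_gen q i)"
    and "z \<in> carrier (quantum_torus q)"
  shows "\<phi> z = \<psi> z"
  using assms(5)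
  by (induction rule: torus_induct)
    (simp_all add: algebra_homD[OF \<phi>] algebra_homD[OF \<psi>] assms(3,4))

section \<open>Sign matrices and transvections\<close>

text \<open>
  Truth values stand for the field of two elements, with \<open>\<noteq>\<close> as addition; \<open>sign_of\<close> is its
  isomorphism onto the group of signs when \<open>- 1 \<noteq> 1\<close>.
\<close>

definition sign_of :: "bool \<Rightarrow> 'a::field" where
  "sign_of c = (if c then - 1 else 1)"

lemma sign_of_mult [simp]: "sign_of c * sign_of d = sign_of (c \<noteq> d)"
  by (simp add: sign_of_def)

lemma sign_of_False [simp]: "sign_of False = 1"
  by (simp add: sign_of_def)

definition sign_mat :: "nat \<Rightarrow> (nat \<Rightarrow> nat \<Rightarrow> bool) \<Rightarrow> 'a::field mat" where
  "sign_mat n b = mat n n (\<lambda>(i, j). sign_of (b i j))"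

lemma sign_mat_simps [simp]:
  "dim_row (sign_mat n b) = n" "dim_col (sign_mat n b) = n"
  "i < n \<Longrightarrow> j < n \<Longrightarrow> sign_mat n b $$ (i, j) = sign_of (b i j)"
  by (simp_all add: sign_mat_def)

definition alternating :: "(nat \<Rightarrow> nat \<Rightarrow> bool) \<Rightarrow> bool" where
  "alternating b \<longleftrightarrow> (\<forall>x. \<not> b x x) \<and> (\<forall>x y. b x y = b y x)"

text \<open>
  The Gram matrix over the field of two elements after the basis vector \<open>e\<^sub>j\<close> is replaced by
  \<open>e\<^sub>j + e\<^sub>i\<close>. The bilinear expansion at \<open>x = y = j\<close> has one more summand, \<open>b i i\<close>, which vanishes for
  alternating \<open>b\<close>.
\<close>

definition transvect :: "nat \<Rightarrow> nat \<Rightarrow> (nat \<Rightarrow> nat \<Rightarrow> bool) \<Rightarrow> nat \<Rightarrow> nat \<Rightarrow> bool" where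
  "transvect i j b x y = ((b x y \<noteq> (x = j \<and> b i y)) \<noteq> (y = j \<and> b x i))"

lemma alternating_transvect:
  assumes "alternating b" "i \<noteq> j"
  shows "alternating (transvect i j b)"
  unfolding alternating_def
proof (intro conjI allI)
  have b: "b x y = b y x" "\<not> b x x" for x y using assms by (auto simp: alternating_def)
  show "\<not> transvect i j b x x" for x
    using b(1)[of i j] b(2) by (auto simp: transvect_def)
  show "transvect i j b x y = transvect i j b y x" for x y
    using b(1)[of x y] b(1)[of x i] b(1)[of y i] by (auto simp: transvect_def)
qed

lemma transvect_transvect:
  assumes "alternating b" "i \<noteq> j"
  shows "transvect i j (transvect i j b) = b"
proof (intro ext)
  fix x y
  have "transvect i j b i y = (b i y \<noteq> (y = j \<and> b i i))" "transvect i j b x i = (b x i \<noteq> (x = j \<and> b i i))"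
    using assms(2) by (auto simp: transvect_def)
  moreover have "\<not> b i i" using assms(1) by (simp add: alternating_def)
  ultimately show "transvect i j (transvect i j b) x y = b x y"
    unfolding transvect_def[of i j "transvect i j b"] by (auto simp: transvect_def[of i j b x y])
qed

context unital_algebra
begin

lemma sign_commute_sym:
  assumes "x \<in> carrier A" "u \<in> carrier A" "x \<otimes> u = sign_of c \<odot> (u \<otimes> x)"
  shows "u \<otimes> x = sign_of c \<odot> (x \<otimes> u)"
  using assms by (simp add: smult_smult)

lemma sign_commute_mult:
  assumes "x \<in> carrier A" "u \<in> carrier A" "w \<in> carrier A"
    and "x \<otimes> u = sign_of c \<odot> (u \<otimes> x)" "x \<otimes> w = sign_of d \<odot> (w \<otimes> x)"
  shows "x \<otimes> (u \<otimes> w) = sign_of (c \<noteq> d) \<odot> ((u \<otimes> w) \<otimes> x)"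
proof -
  have "x \<otimes> (u \<otimes> w) = sign_of c \<odot> (u \<otimes> (x \<otimes> w))"
    using assms by (simp add: smult_mult_left flip: m_assoc) (simp add: m_assoc)
  also have "\<dots> = sign_of (c \<noteq> d) \<odot> ((u \<otimes> w) \<otimes> x)"
    using assms by (simp add: smult_mult_right smult_smult m_assoc)
  finally show ?thesis .
qed

text \<open>
  A sign is its own inverse, so an element and its inverse commute with \<open>x\<close> up to the same sign.
\<close>

lemma sign_commute_inverse:
  assumes x: "x \<in> carrier A" "u \<in> carrier A" "u' \<in> carrier A"
    and inv: "u \<otimes> u' = \<one>" "u' \<otimes> u = \<one>"
    and xu: "x \<otimes> u = sign_of c \<odot> (u \<otimes> x)"
  shows "x \<otimes> u' = sign_of c \<odot> (u' \<otimes> x)"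
proof -
  have "x \<otimes> u' = u' \<otimes> (u \<otimes> x) \<otimes> u'"
    using x inv by (simp flip: m_assoc)
  also have "\<dots> = sign_of c \<odot> (u' \<otimes> (x \<otimes> u) \<otimes> u')"
    using sign_commute_sym[OF x(1,2) xu] x by (simp add: smult_mult_left smult_mult_right)
  also have "u' \<otimes> (x \<otimes> u) \<otimes> u' = u' \<otimes> x"
    using x inv by (simp add: m_assoc)
  finally show ?thesis .
qed

end

text \<open>
  Multiplying \<open>t\<^sub>j\<close> by a unit \<open>u\<close> whose commutation signs are those of \<open>t\<^sub>i\<close> adds row \<open>i\<close> of the sign form
  to row \<open>j\<close>, so the new family satisfies the relations of the transvected form. Both \<open>u = t\<^sub>i\<close> and
  \<open>u = t\<^sub>i\<^sup>-\<^sup>1\<close> qualify, which is what makes the substitution invertible.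
\<close>

lemma transvect_hom:
  assumes b: "alternating b" and ij: "i < n" "j < n" "i \<noteq> j"
    and u: "u \<in> carrier (quantum_torus q)" "u' \<in> carrier (quantum_torus q)"
      "u \<otimes>\<^bsub>quantum_torus q\<^esub> u' = \<one>\<^bsub>quantum_torus q\<^esub>" "u' \<otimes>\<^bsub>quantum_torus q\<^esub> u = \<one>\<^bsub>quantum_torus q\<^esub>"
    and comm: "\<And>k. k < n \<Longrightarrow> torus_gen q k \<otimes>\<^bsub>quantum_torus q\<^esub> u
        = sign_of (b i k) \<odot>\<^bsub>quantum_torus q\<^esub> (u \<otimes>\<^bsub>quantum_torus q\<^esub> torus_gen q k)"
    and q: "q = sign_mat n b"
  obtains g where "g \<in> algebra_hom (quantum_torus (sign_mat n (transvect i j b))) (quantum_torus q)"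
    "\<And>k. k < n \<Longrightarrow> g (torus_gen (sign_mat n (transvect i j b)) k)
        = (if k = j then torus_gen q j \<otimes>\<^bsub>quantum_torus q\<^esub> u else torus_gen q k)"
    "\<And>k. k < n \<Longrightarrow> g (torus_inv_gen (sign_mat n (transvect i j b)) k)
        = (if k = j then u' \<otimes>\<^bsub>quantum_torus q\<^esub> torus_inv_gen q j else torus_inv_gen q k)"
proof -
  define A where "A = quantum_torus q"
  interpret A: unital_algebra A unfolding A_def by (rule unital_algebra_quantum_torus)
  let ?t = "torus_gen q" and ?t' = "torus_inv_gen q"
  have ts: "toral_system A q ?t ?t'" unfolding A_def by (rule toral_system_torus_gen)
  have t: "?t k \<in> carrier A" "?t' k \<in> carrier A" "?t k \<otimes>\<^bsub>A\<^esub> ?t' k = \<one>\<^bsub>A\<^esub>" "?t' k \<otimes>\<^bsub>A\<^esub> ?t k = \<one>\<^bsub>A\<^esub>"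
    if "k < n" for k
    using toral_systemD(1-4)[OF ts, of k] that by (simp_all add: q)
  have tt: "?t k \<otimes>\<^bsub>A\<^esub> ?t l = sign_of (b l k) \<odot>\<^bsub>A\<^esub> (?t l \<otimes>\<^bsub>A\<^esub> ?t k)" if "k < n" "l < n" for k l
    using toral_systemD(5)[OF ts, of l k] that by (simp add: q)
  note u = u[folded A_def] and comm = comm[folded A_def]
  have tj: "?t k \<otimes>\<^bsub>A\<^esub> (?t j \<otimes>\<^bsub>A\<^esub> u)
      = sign_of (b j k \<noteq> b i k) \<odot>\<^bsub>A\<^esub> ((?t j \<otimes>\<^bsub>A\<^esub> u) \<otimes>\<^bsub>A\<^esub> ?t k)" if "k < n" for k
    by (rule A.sign_commute_mult[OF t(1)[OF that] t(1)[OF ij(2)] u(1) tt[OF that ij(2)] comm[OF that]])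
  have tj': "(?t j \<otimes>\<^bsub>A\<^esub> u) \<otimes>\<^bsub>A\<^esub> ?t k
      = sign_of (b j k \<noteq> b i k) \<odot>\<^bsub>A\<^esub> (?t k \<otimes>\<^bsub>A\<^esub> (?t j \<otimes>\<^bsub>A\<^esub> u))" if "k < n" for k
    by (rule A.sign_commute_sym[OF t(1)[OF that] A.m_closed[OF t(1)[OF ij(2)] u(1)] tj[OF that]])
  have inv: "(?t j \<otimes>\<^bsub>A\<^esub> u) \<otimes>\<^bsub>A\<^esub> (u' \<otimes>\<^bsub>A\<^esub> ?t' j) = \<one>\<^bsub>A\<^esub>"
    "(u' \<otimes>\<^bsub>A\<^esub> ?t' j) \<otimes>\<^bsub>A\<^esub> (?t j \<otimes>\<^bsub>A\<^esub> u) = \<one>\<^bsub>A\<^esub>"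
  proof -
    have "(?t j \<otimes>\<^bsub>A\<^esub> u) \<otimes>\<^bsub>A\<^esub> (u' \<otimes>\<^bsub>A\<^esub> ?t' j) = ?t j \<otimes>\<^bsub>A\<^esub> (u \<otimes>\<^bsub>A\<^esub> u') \<otimes>\<^bsub>A\<^esub> ?t' j"
      using t u(1,2) ij by (simp add: A.m_assoc)
    then show "(?t j \<otimes>\<^bsub>A\<^esub> u) \<otimes>\<^bsub>A\<^esub> (u' \<otimes>\<^bsub>A\<^esub> ?t' j) = \<one>\<^bsub>A\<^esub>" using t u ij by simp
    have "(u' \<otimes>\<^bsub>A\<^esub> ?t' j) \<otimes>\<^bsub>A\<^esub> (?t j \<otimes>\<^bsub>A\<^esub> u) = u' \<otimes>\<^bsub>A\<^esub> (?t' j \<otimes>\<^bsub>A\<^esub> ?t j) \<otimes>\<^bsub>A\<^esub> u"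
      using t(1,2) u(1,2) ij by (simp add: A.m_assoc)
    then show "(u' \<otimes>\<^bsub>A\<^esub> ?t' j) \<otimes>\<^bsub>A\<^esub> (?t j \<otimes>\<^bsub>A\<^esub> u) = \<one>\<^bsub>A\<^esub>" using t u ij by simp
  qed
  have "toral_system A (sign_mat n (transvect i j b))
      (\<lambda>k. if k = j then ?t j \<otimes>\<^bsub>A\<^esub> u else ?t k) (\<lambda>k. if k = j then u' \<otimes>\<^bsub>A\<^esub> ?t' j else ?t' k)"
    unfolding toral_system_def
  proof (intro conjI allI impI, goal_cases)
    case (5 k l)
    then have kl: "k < n" "l < n" by auto
    have b': "\<not> b k k" "b k l = b l k" for k l using b by (auto simp: alternating_def)
    have tr: "transvect i j b k l = ((b k l \<noteq> (k = j \<and> b i l)) \<noteq> (l = j \<and> b k i))"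
      by (rule transvect_def)
    consider "k = j" "l = j" | "k = j" "l \<noteq> j" | "k \<noteq> j" "l = j" | "k \<noteq> j" "l \<noteq> j" by blast
    then show ?case
    proof cases
      case 1
      then have "\<not> transvect i j b k l" using b' unfolding tr by blast
      then show ?thesis using 1 kl t u ij by simp
    next
      case 2
      then have "transvect i j b k l = (b j l \<noteq> b i l)" unfolding tr by blast
      then show ?thesis using 2 kl tj[OF kl(2)] by simp
    next
      case 3
      then have "transvect i j b k l = (b j k \<noteq> b i k)" using b' unfolding tr by blast
      then show ?thesis using 3 kl tj'[OF kl(1)] by simp
    next
      case 4
      then have "transvect i j b k l = b k l" unfolding tr by blast
      then show ?thesis using 4 kl tt[OF kl(2,1)] by simp
    qed
  qed (use t u inv ij in \<open>auto\<close>)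
  from quantum_torus_universal[OF A.unital_algebra_axioms this] that show ?thesis
    unfolding A_def by auto
qed

text \<open>
  Two substitutions \<open>t\<^sub>j \<mapsto> t\<^sub>j t\<^sub>i\<close> and \<open>t\<^sub>j \<mapsto> t\<^sub>j t\<^sub>i\<^sup>-\<^sup>1\<close> undo each other. The second one is again a
  homomorphism of the required kind because a transvection of a form over the field of two elements
  is an involution.
\<close>

lemma transvect_isomorphic:
  assumes b: "alternating b" and ij: "i < n" "j < n" "i \<noteq> j"
  shows "algebra_isomorphic (quantum_torus (sign_mat n (transvect i j b) :: 'a::field mat))
           (quantum_torus (sign_mat n b))"
proof -
  let ?b = "transvect i j b"
  have comm: "torus_gen (sign_mat n b) k \<otimes>\<^bsub>quantum_torus (sign_mat n b)\<^esub> torus_gen (sign_mat n b) i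
        = sign_of (b i k) \<odot>\<^bsub>quantum_torus (sign_mat n b)\<^esub>
          (torus_gen (sign_mat n b) i \<otimes>\<^bsub>quantum_torus (sign_mat n b)\<^esub> torus_gen (sign_mat n b :: 'a mat) k)"
    if "k < n" for b k
    using toral_systemD(5)[OF toral_system_torus_gen[of "sign_mat n b"], of i k] that ij by simp
  have gens: "torus_gen (sign_mat n b) k \<in> carrier (quantum_torus (sign_mat n b))"
      "torus_inv_gen (sign_mat n b) k \<in> carrier (quantum_torus (sign_mat n b))"
      "torus_gen (sign_mat n b) k \<otimes>\<^bsub>quantum_torus (sign_mat n b)\<^esub> torus_inv_gen (sign_mat n b) k
        = \<one>\<^bsub>quantum_torus (sign_mat n b)\<^esub>"
      "torus_inv_gen (sign_mat n b) k \<otimes>\<^bsub>quantum_torus (sign_mat n b)\<^esub> torus_gen (sign_mat n b) k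
        = \<one>\<^bsub>quantum_torus (sign_mat n b :: 'a mat)\<^esub>"
    if "k < n" for b k
    using toral_systemD(1-4)[OF toral_system_torus_gen[of "sign_mat n b"], of k] that by simp_all
  let ?q = "sign_mat n b :: 'a mat" and ?q' = "sign_mat n ?b :: 'a mat"
  interpret A: unital_algebra "quantum_torus ?q" by (rule unital_algebra_quantum_torus)
  interpret A': unital_algebra "quantum_torus ?q'" by (rule unital_algebra_quantum_torus)
  obtain f where f: "f \<in> algebra_hom (quantum_torus ?q') (quantum_torus ?q)"
    "\<And>k. k < n \<Longrightarrow> f (torus_gen ?q' k)
        = (if k = j then torus_gen ?q j \<otimes>\<^bsub>quantum_torus ?q\<^esub> torus_gen ?q i else torus_gen ?q k)"
    "\<And>k. k < n \<Longrightarrow> f (torus_inv_gen ?q' k)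
        = (if k = j then torus_inv_gen ?q i \<otimes>\<^bsub>quantum_torus ?q\<^esub> torus_inv_gen ?q j else torus_inv_gen ?q k)"
    using transvect_hom[OF b ij gens(1,2)[OF ij(1), of b] gens(3,4)[OF ij(1), of b] comm refl] by blast
  have comm': "torus_gen ?q' k \<otimes>\<^bsub>quantum_torus ?q'\<^esub> torus_inv_gen ?q' i
      = sign_of (?b i k) \<odot>\<^bsub>quantum_torus ?q'\<^esub> (torus_inv_gen ?q' i \<otimes>\<^bsub>quantum_torus ?q'\<^esub> torus_gen ?q' k)"
    if "k < n" for k
    by (rule A'.sign_commute_inverse[OF gens(1)[OF that] gens(1,2,3,4)[OF ij(1)] comm[OF that]])
  obtain g where g: "g \<in> algebra_hom (quantum_torus ?q) (quantum_torus ?q')"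
    "\<And>k. k < n \<Longrightarrow> g (torus_gen ?q k)
        = (if k = j then torus_gen ?q' j \<otimes>\<^bsub>quantum_torus ?q'\<^esub> torus_inv_gen ?q' i else torus_gen ?q' k)"
    "\<And>k. k < n \<Longrightarrow> g (torus_inv_gen ?q k)
        = (if k = j then torus_gen ?q' i \<otimes>\<^bsub>quantum_torus ?q'\<^esub> torus_inv_gen ?q' j else torus_inv_gen ?q' k)"
    using transvect_hom[OF alternating_transvect[OF b ij(3)] ij gens(2,1)[OF ij(1), of ?b]
        gens(4,3)[OF ij(1), of ?b] comm' refl]
    unfolding transvect_transvect[OF b ij(3)] by blast
  have id: "(\<lambda>x. x) \<in> algebra_hom C C" for C :: "('a, 'a torus_element) module"
    by (rule algebra_homI) auto
  note fh = algebra_homD[OF f(1)] and gh = algebra_homD[OF g(1)]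
  have cancel: "x \<otimes>\<^bsub>quantum_torus q\<^esub> y \<otimes>\<^bsub>quantum_torus q\<^esub> z = x"
    "y \<otimes>\<^bsub>quantum_torus q\<^esub> (z \<otimes>\<^bsub>quantum_torus q\<^esub> x) = x"
    if "y \<otimes>\<^bsub>quantum_torus q\<^esub> z = \<one>\<^bsub>quantum_torus q\<^esub>" "x \<in> carrier (quantum_torus q)"
      "y \<in> carrier (quantum_torus q)" "z \<in> carrier (quantum_torus q)" for x y z and q :: "'a mat"
  proof -
    interpret unital_algebra "quantum_torus q" by (rule unital_algebra_quantum_torus)
    show "x \<otimes>\<^bsub>quantum_torus q\<^esub> y \<otimes>\<^bsub>quantum_torus q\<^esub> z = x" using that by (simp add: m_assoc)
    show "y \<otimes>\<^bsub>quantum_torus q\<^esub> (z \<otimes>\<^bsub>quantum_torus q\<^esub> x) = x" using that by (simp flip: m_assoc)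
  qed
  have "(f \<circ> g) z = z" if "z \<in> carrier (quantum_torus ?q)" for z
    by (rule torus_hom_eq[OF algebra_hom_comp[OF g(1) f(1)] id _ _ that])
      (use ij in \<open>auto simp: f g fh gens cancel\<close>)
  moreover have "(g \<circ> f) z = z" if "z \<in> carrier (quantum_torus ?q')" for z
    by (rule torus_hom_eq[OF algebra_hom_comp[OF f(1) g(1)] id _ _ that])
      (use ij in \<open>auto simp: f g gh gens cancel\<close>)
  ultimately have "f \<in> algebra_isos (quantum_torus ?q') (quantum_torus ?q)"
    using algebra_isos_of_inverse_homs[OF f(1) g(1)] by simp
  then show ?thesis by (auto simp: algebra_isomorphic_def)
qed

section \<open>Alternating forms modulo two\<close>

text \<open>
  The orthogonal sum of \<open>l\<close> hyperbolic planes, spanned by the basis vectors \<open>2 i\<close> and \<open>2 i + 1\<close> for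
  \<open>i < l\<close>, and a zero form.
\<close>

definition hyperbolic :: "nat \<Rightarrow> nat \<Rightarrow> nat \<Rightarrow> bool" where
  "hyperbolic l x y \<longleftrightarrow> x \<noteq> y \<and> x div 2 = y div 2 \<and> x < 2 * l"

definition transvects_to :: "nat \<Rightarrow> (nat \<Rightarrow> nat \<Rightarrow> bool) \<Rightarrow> (nat \<Rightarrow> nat \<Rightarrow> bool) \<Rightarrow> bool" where
  "transvects_to n = (\<lambda>b b'. \<exists>i<n. \<exists>j<n. i \<noteq> j \<and> b' = transvect i j b)\<^sup>*\<^sup>*"

lemma transvects_to_refl: "transvects_to n b b"
  by (simp add: transvects_to_def)

lemma transvects_to_trans: "transvects_to n b c \<Longrightarrow> transvects_to n c d \<Longrightarrow> transvects_to n b d"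
  by (simp add: transvects_to_def)

lemma transvects_to_transvect:
  "i < n \<Longrightarrow> j < n \<Longrightarrow> i \<noteq> j \<Longrightarrow> transvects_to n b (transvect i j b)"
  unfolding transvects_to_def by blast

lemma transvects_to_alternating: "transvects_to n b c \<Longrightarrow> alternating b \<Longrightarrow> alternating c"
  unfolding transvects_to_def
  by (induction rule: rtranclp_induct) (auto intro: alternating_transvect)

lemma transvects_to_isomorphic:
  assumes "transvects_to n b c" "alternating b"
  shows "algebra_isomorphic (quantum_torus (sign_mat n b :: 'a::field mat)) (quantum_torus (sign_mat n c))"
  using assms(1) unfolding transvects_to_def
proof (induction rule: rtranclp_induct)
  case (step c d)
  then have "alternating c" using transvects_to_alternating assms(2) by (auto simp: transvects_to_def)
  with step obtain i j where "algebra_isomorphic (quantum_torus (sign_mat n d :: 'a mat)) (quantum_torus (sign_mat n c))"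
    using transvect_isomorphic by blast
  then show ?case
    using step.IH unital_algebra.algebra_isomorphic_sym[OF unital_algebra_quantum_torus]
      algebra_isomorphic_trans by blast
qed (rule algebra_isomorphic_refl)

text \<open>
  Modulo two, adding \<open>e\<^sub>i\<close> to \<open>e\<^sub>j\<close>, then \<open>e\<^sub>j\<close> to \<open>e\<^sub>i\<close>, then \<open>e\<^sub>i\<close> to \<open>e\<^sub>j\<close> exchanges the two vectors, so
  transvections alone generate all the base changes that are needed.
\<close>

lemma transvects_to_swap:
  assumes b: "alternating b" and ij: "i < n" "j < n"
  shows "transvects_to n b (\<lambda>x y. b (transpose i j x) (transpose i j y))"
proof (cases "i = j")
  case True
  then show ?thesis by (simp add: transvects_to_refl)
next
  case False
  have "transvect i j (transvect j i (transvect i j b)) x y = b (transpose i j x) (transpose i j y)" for x y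
    using b False
    by (cases "x = i"; cases "x = j"; cases "y = i"; cases "y = j")
      (simp_all add: alternating_def transvect_def, blast+)
  then have "(\<lambda>x y. b (transpose i j x) (transpose i j y))
      = transvect i j (transvect j i (transvect i j b))"
    by (simp add: fun_eq_iff)
  then show ?thesis
    using ij False by (auto intro: transvects_to_trans transvects_to_transvect)
qed

lemma same_pair_less: "x div 2 = y div 2 \<Longrightarrow> x < 2 * r \<Longrightarrow> y < 2 * r" for x y r :: nat
  using div_less_iff_less_mult[of 2 x r] div_less_iff_less_mult[of 2 y r] by (simp add: mult.commute)

lemma hyperbolic_row:
  assumes "x < 2 * r" "2 * r \<le> y"
  shows "\<not> hyperbolic s x y"
  using assms same_pair_less[of x y r] by (auto simp: hyperbolic_def)

text \<open>
  Once \<open>e = e\<^bsub>2r\<^esub>\<close> and \<open>f = e\<^bsub>2r+1\<^esub>\<close> form a hyperbolic pair, every later basis vector \<open>z\<close> becomes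
  orthogonal to both by adding \<open>f\<close> if \<open>z\<close> pairs with \<open>e\<close>, and \<open>e\<close> if it pairs with \<open>f\<close>. The induction
  treats the vectors \<open>z < m\<close> one at a time; the planes split off before are orthogonal to \<open>e\<close> and \<open>f\<close>,
  so they are not disturbed.
\<close>

lemma clear_rows:
  assumes b: "alternating b" and r: "2 * r + 2 \<le> m" "m \<le> n"
    and split: "\<forall>x<2*r. \<forall>y<n. b x y = hyperbolic r x y"
    and pair: "b (2 * r) (2 * r + 1)"
  shows "\<exists>c. transvects_to n b c \<and> (\<forall>x<2*r. \<forall>y<n. c x y = hyperbolic r x y)
    \<and> c (2 * r) (2 * r + 1) \<and> (\<forall>z. 2 * r + 2 \<le> z \<and> z < m \<longrightarrow> \<not> c (2 * r) z \<and> \<not> c (2 * r + 1) z)"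
  using r
proof (induction m rule: dec_induct)
  case base
  show ?case by (rule exI[of _ b]) (use split pair transvects_to_refl in auto)
next
  case (step m)
  let ?i = "2 * r" and ?j = "2 * r + 1"
  have m: "?j < m" "m < n" using step by auto
  obtain c where c: "transvects_to n b c" "\<forall>x<?i. \<forall>y<n. c x y = hyperbolic r x y" "c ?i ?j"
    "\<And>z. 2 * r + 2 \<le> z \<Longrightarrow> z < m \<Longrightarrow> \<not> c ?i z \<and> \<not> c ?j z"
    using step by auto
  have alt: "alternating c" using transvects_to_alternating c(1) b by blast
  then have sym: "c x y = c y x" "\<not> c x x" for x y by (auto simp: alternating_def)
  have zero: "\<not> c x ?i" "\<not> c x ?j" "\<not> c ?i x" "\<not> c ?j x" if "x < ?i" for x
    using c(2) that m hyperbolic_row[OF that, of ?i r] hyperbolic_row[OF that, of ?j r] sym by auto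
  define d where "d = (if c ?i m then transvect ?j m c else c)"
  have d: "transvects_to n c d" "alternating d"
    using alt m by (auto simp: d_def transvects_to_refl transvects_to_transvect alternating_transvect)
  have dval: "d x y = ((c x y \<noteq> (c ?i m \<and> x = m \<and> c ?j y)) \<noteq> (c ?i m \<and> y = m \<and> c x ?j))" for x y
    by (simp add: d_def transvect_def)
  define e where "e = (if d ?j m then transvect ?i m d else d)"
  have e: "transvects_to n d e"
    using d m by (auto simp: e_def transvects_to_refl transvects_to_transvect)
  have eval: "e x y = ((d x y \<noteq> (d ?j m \<and> x = m \<and> d ?i y)) \<noteq> (d ?j m \<and> y = m \<and> d x ?i))" for x y
    by (simp add: e_def transvect_def)
  have d1: "d x y = c x y" if "x \<noteq> m" "y \<noteq> m" for x y using that by (simp add: dval)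
  have e1: "e x y = c x y" if "x \<noteq> m" "y \<noteq> m" for x y using that by (simp add: eval d1)
  have dj: "d ?j m = c ?j m" using m sym by (simp add: dval)
  have di: "\<not> d ?i m" using m sym c(3) by (simp add: dval)
  have ei: "\<not> e ?i m" using m sym di d1[of ?i ?i] by (simp add: eval)
  have ej: "\<not> e ?j m" using m sym d1[of ?j ?i] c(3) by (simp add: eval dj)
  have dx: "d x m = c x m" if "x < ?i" for x using that zero m by (simp add: dval)
  have ex: "e x m = c x m" if "x < ?i" for x using that zero m d1[of x ?i] by (simp add: eval dx)
  have "\<forall>x<?i. \<forall>y<n. e x y = hyperbolic r x y"
  proof (intro allI impI)
    fix x y assume "x < ?i" "y < n"
    then have "e x y = c x y" using ex e1[of x y] m by (cases "y = m") auto
    then show "e x y = hyperbolic r x y" using c(2) \<open>x < ?i\<close> \<open>y < n\<close> by simp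
  qed
  moreover have "e ?i ?j" using e1[of ?i ?j] c(3) m by simp
  moreover have "\<not> e ?i z \<and> \<not> e ?j z" if "2 * r + 2 \<le> z" "z < Suc m" for z
    using ei ej e1[of ?i z] e1[of ?j z] c(4)[of z] that m by (cases "z = m") auto
  moreover have "transvects_to n b e" using c(1) d(1) e transvects_to_trans by blast
  ultimately show ?case by blast
qed

text \<open>
  As long as the form is nonzero on the vectors from \<open>2 r\<close> on, two of them that pair nontrivially are
  moved to the positions \<open>2 r\<close> and \<open>2 r + 1\<close> and the rest is made orthogonal to them; this splits off
  one more hyperbolic plane.
\<close>

lemma hyperbolic_form_reached:
  assumes "alternating b" "2 * r \<le> n" "\<forall>x<2*r. \<forall>y<n. b x y = hyperbolic r x y"
  shows "\<exists>l c. 2 * l \<le> n \<and> transvects_to n b c \<and> (\<forall>x<n. \<forall>y<n. c x y = hyperbolic l x y)"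
  using assms
proof (induction "n - 2 * r" arbitrary: r b rule: less_induct)
  case less
  note b = less.prems(1) and split = less.prems(3)
  have sym: "b x y = b y x" "\<not> b x x" for x y using b by (auto simp: alternating_def)
  show ?case
  proof (cases "\<exists>x y. 2 * r \<le> x \<and> x < n \<and> 2 * r \<le> y \<and> y < n \<and> b x y")
    case False
    have "b x y = hyperbolic r x y" if "x < n" "y < n" for x y
    proof (cases "x < 2 * r")
      case x: False
      show ?thesis
      proof (cases "y < 2 * r")
        case True
        then have "b y x = hyperbolic r y x" using split that by blast
        then show ?thesis using hyperbolic_row[of y r x r] True x sym(1)[of x y]
          by (auto simp: hyperbolic_def)
      qed (use False x that in \<open>auto simp: hyperbolic_def\<close>)
    qed (use split that in blast)
    then show ?thesis using less.prems(2) transvects_to_refl by blast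
  next
    case True
    then obtain x y where xy: "2 * r \<le> x" "x < n" "2 * r \<le> y" "y < n" "b x y" by blast
    let ?i = "2 * r" and ?j = "2 * r + 1"
    have "x \<noteq> y" using xy sym by blast
    then have n: "?j < n" using xy by linarith
    \<comment> \<open>Position of the second vector after the first one has been moved.\<close>
    define y' where "y' = transpose ?i x y"
    have y': "?i < y'" "y' < n"
      using xy \<open>x \<noteq> y\<close> n by (auto simp: y'_def transpose_def)
    define c where "c = (\<lambda>x1 y1. b (transpose ?i x x1) (transpose ?i x y1))"
    have c: "transvects_to n b c" unfolding c_def by (rule transvects_to_swap) (use b n xy in auto)
    have altc: "alternating c" using transvects_to_alternating c b by blast
    have "c ?i y'" using xy by (simp add: c_def y'_def)
    define d where "d = (\<lambda>x1 y1. c (transpose ?j y' x1) (transpose ?j y' y1))"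
    have d: "transvects_to n c d" unfolding d_def by (rule transvects_to_swap) (use altc n y' in auto)
    have altd: "alternating d" using transvects_to_alternating d altc by blast
    have pair: "d ?i ?j" using \<open>c ?i y'\<close> y' by (simp add: d_def transpose_def)
    have "d x1 y1 = hyperbolic r x1 y1" if "x1 < ?i" "y1 < n" for x1 y1
    proof -
      let ?\<tau> = "\<lambda>z. transpose ?i x (transpose ?j y' z)"
      have \<tau>: "?\<tau> x1 = x1" "?\<tau> y1 < n" "?\<tau> y1 = y1 \<or> (?i \<le> y1 \<and> ?i \<le> ?\<tau> y1)"
        using that xy y' n by (auto simp: transpose_def)
      have "d x1 y1 = b (?\<tau> x1) (?\<tau> y1)" by (simp add: d_def c_def)
      also have "\<dots> = hyperbolic r x1 (?\<tau> y1)" using split that \<tau> by simp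
      also have "\<dots> = hyperbolic r x1 y1"
        using \<tau>(3) hyperbolic_row[OF that(1), of y1 r] hyperbolic_row[OF that(1), of "?\<tau> y1" r] by metis
      finally show ?thesis .
    qed
    then obtain e where e: "transvects_to n d e" "\<forall>x<?i. \<forall>y<n. e x y = hyperbolic r x y" "e ?i ?j"
      "\<And>z. 2 * r + 2 \<le> z \<Longrightarrow> z < n \<Longrightarrow> \<not> e ?i z \<and> \<not> e ?j z"
      using clear_rows[of d r n n, OF altd _ order_refl _ pair] n by auto
    have alte: "alternating e" using transvects_to_alternating e(1) altd by blast
    then have syme: "e x y = e y x" "\<not> e x x" for x y by (auto simp: alternating_def)
    have "e x y = hyperbolic (Suc r) x y" if "x < 2 * Suc r" "y < n" for x y
    proof -
      have "x < ?i \<or> x = ?i \<or> x = ?j" using \<open>x < 2 * Suc r\<close> by auto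
      then consider "x < ?i" | "x = ?i" | "x = ?j" by blast
      then show ?thesis
      proof cases
        case 1
        then show ?thesis using e(2) that by (simp add: hyperbolic_def)
      next
        case 2
        consider "y < ?i" | "y = ?i" | "y = ?j" | "2 * r + 2 \<le> y" by linarith
        then show ?thesis
        proof cases
          case 1
          then have "\<not> e y x" using e(2) 2 n hyperbolic_row[of y r x r] by auto
          then show ?thesis using syme(1)[of y x] 1 2 by (auto simp: hyperbolic_def)
        qed (use 2 e(3) e(4)[of y] syme that in \<open>auto simp: hyperbolic_def\<close>)
      next
        case 3
        consider "y < ?i" | "y = ?i" | "y = ?j" | "2 * r + 2 \<le> y" by linarith
        then show ?thesis
        proof cases
          case 1
          then have "\<not> e y x" using e(2) 3 n hyperbolic_row[of y r x r] by auto
          then show ?thesis using syme(1)[of y x] 1 3 by (auto simp: hyperbolic_def)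
        qed (use 3 e(3) e(4)[of y] syme that in \<open>auto simp: hyperbolic_def\<close>)
      qed
    qed
    moreover have "n - 2 * Suc r < n - 2 * r" "2 * Suc r \<le> n" using n by auto
    ultimately obtain l f where "2 * l \<le> n" "transvects_to n e f" "\<forall>x<n. \<forall>y<n. f x y = hyperbolic l x y"
      using less.hyps[of "Suc r" e] alte by blast
    moreover have "transvects_to n b f"
      using c d e(1) \<open>transvects_to n e f\<close> transvects_to_trans by blast
    ultimately show ?thesis by blast
  qed
qed

lemma h_mat_eq_sign_mat:
  "2 * l \<le> n \<Longrightarrow> (h_mat l n :: 'a::field mat) = sign_mat n (hyperbolic l)"
proof (induction l arbitrary: n)
  case 0
  show ?case
    by (rule eq_matI) (auto simp: h_mat_def ones_mat_def hyperbolic_def)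
next
  case (Suc l)
  let ?B = "sign_mat (n - 2) (hyperbolic l) :: 'a mat"
  have "(h_mat (Suc l) n :: 'a mat) = block_product h_block (h_mat l (n - 2))"
    by (simp add: h_mat_def diff_diff_left)
  also have "\<dots> = block_product h_block ?B"
    using Suc by simp
  also have "\<dots> = sign_mat n (hyperbolic (Suc l))"
  proof (rule eq_matI)
    have h: "dim_row (h_block :: 'a mat) = 2" "dim_col (h_block :: 'a mat) = 2"
      by (simp_all add: h_block_def mat_of_rows_list_def)
    have hv: "h_block $$ (i, j) = (if i = j then 1 else - 1 :: 'a)" if "i < 2" "j < 2" for i j
      using that by (auto simp: h_block_def mat_of_rows_list_def less_2_cases_iff)
    show "dim_row (block_product h_block ?B) = dim_row (sign_mat n (hyperbolic (Suc l)) :: 'a mat)"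
      "dim_col (block_product h_block ?B) = dim_col (sign_mat n (hyperbolic (Suc l)) :: 'a mat)"
      using Suc.prems by (simp_all add: block_product_def h)
    fix i j assume "i < dim_row (sign_mat n (hyperbolic (Suc l)) :: 'a mat)"
      "j < dim_col (sign_mat n (hyperbolic (Suc l)) :: 'a mat)"
    then have ij: "i < n" "j < n" by auto
    have div: "(i - 2) div 2 = (j - 2) div 2 \<longleftrightarrow> i div 2 = j div 2" if "2 \<le> i" "2 \<le> j"
      using that by (metis Suc_diff_1 add_diff_cancel_left' le_add_diff_inverse2 div_add_self2 zero_neq_numeral add_right_cancel)
    have small: "k div 2 = 0 \<longleftrightarrow> k < 2" for k :: nat by auto
    have "block_product h_block ?B $$ (i, j)
        = (if i < 2 then if j < 2 then h_block $$ (i, j) else 1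
           else if j < 2 then 1 else ?B $$ (i - 2, j - 2))"
      using ij Suc.prems by (simp add: block_product_def h ones_mat_def)
    also have "\<dots> = sign_of (hyperbolic (Suc l) i j)"
    proof -
      have 1: "hyperbolic (Suc l) i j \<longleftrightarrow> i \<noteq> j" if "i < 2" "j < 2"
        using that by (auto simp: hyperbolic_def small)
      have 2: "\<not> hyperbolic (Suc l) i j" if "i < 2 \<longleftrightarrow> \<not> j < 2"
        using that small by (metis hyperbolic_def)
      have 3: "hyperbolic (Suc l) i j \<longleftrightarrow> hyperbolic l (i - 2) (j - 2)" if "\<not> i < 2" "\<not> j < 2"
        using that div by (auto simp: hyperbolic_def)
      show ?thesis using 1 2 3 ij by (auto simp: hv sign_of_def)
    qed
    also have "\<dots> = sign_mat n (hyperbolic (Suc l)) $$ (i, j)" using ij by simp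
    finally show "block_product h_block ?B $$ (i, j) = sign_mat n (hyperbolic (Suc l)) $$ (i, j)" .
  qed
  finally show ?case .
qed

lemma alternating_hyperbolic: "alternating (hyperbolic l)"
proof -
  have "hyperbolic l x y = hyperbolic l y x" for x y
    using same_pair_less[of x y l] same_pair_less[of y x l] by (auto simp: hyperbolic_def)
  then show ?thesis unfolding alternating_def by (simp add: hyperbolic_def)
qed

text \<open>
  An elementary quantum matrix is the exponential of an alternating form over the field of two
  elements, and such a form is equivalent to a sum of hyperbolic planes and a zero form.
\<close>

lemma isomorphic_to_h_mat:
  fixes \<epsilon> :: "'a::field mat"
  assumes "elementary_quantum_matrix n \<epsilon>"
  obtains l where "2 * l \<le> n" "algebra_isomorphic (quantum_torus \<epsilon>) (quantum_torus (h_mat l n))"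
proof -
  define b where "b x y = (x < n \<and> y < n \<and> x \<noteq> y \<and> \<epsilon> $$ (x, y) \<noteq> 1)" for x y
  have qm: "quantum_matrix n \<epsilon>"
    using assms unfolding elementary_quantum_matrix_def by (rule conjunct1)
  have el: "\<epsilon> $$ (i, j) \<in> {1, - 1}" if "i < n" "j < n" for i j
    using assms that unfolding elementary_quantum_matrix_def by blast
  note qm' = qm[unfolded quantum_matrix_def]
  have q: "\<epsilon> \<in> carrier_mat n n"
    by (rule conjunct1[OF qm'])
  have diag: "\<forall>i<n. \<epsilon> $$ (i, i) = 1"
    by (rule conjunct1[OF conjunct2[OF qm']])
  have inv_all: "\<forall>i<n. \<forall>j<n. \<epsilon> $$ (i, j) \<noteq> 0 \<and> \<epsilon> $$ (j, i) = inverse (\<epsilon> $$ (i, j))"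
    by (rule conjunct2[OF conjunct2[OF qm']])
  have inv: "\<epsilon> $$ (j, i) = inverse (\<epsilon> $$ (i, j))" if "i < n" "j < n" for i j
    using inv_all[rule_format, OF that] by (rule conjunct2)
  have \<epsilon>: "\<epsilon> = sign_mat n b"
    by (rule eq_matI) (use q diag el in \<open>auto simp: sign_of_def b_def\<close>)
  have "alternating b"
    unfolding alternating_def
  proof (intro conjI allI)
    show "b x y = b y x" for x y
    proof (cases "x < n \<and> y < n")
      case True
      then show ?thesis using inv[of x y] by (auto simp: b_def)
    qed (auto simp: b_def)
  qed (simp add: b_def)
  then obtain l c where l: "2 * l \<le> n" and c: "transvects_to n b c"
    "\<forall>x<n. \<forall>y<n. c x y = hyperbolic l x y"
    using hyperbolic_form_reached[of b 0 n] by auto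
  have "sign_mat n c = (h_mat l n :: 'a mat)"
    unfolding h_mat_eq_sign_mat[OF l] using c by (auto intro!: eq_matI)
  with transvects_to_isomorphic[OF c(1) \<open>alternating b\<close>] l that \<epsilon> show ?thesis by metis
qed

section \<open>Monomials and the centre\<close>

context unital_algebra
begin

lemma Units_I:
  "u \<in> carrier A \<Longrightarrow> u' \<in> carrier A \<Longrightarrow> u \<otimes> u' = \<one> \<Longrightarrow> u' \<otimes> u = \<one> \<Longrightarrow> u \<in> Units A"
  by (auto simp: Units_def)

lemma nat_pow_Units:
  assumes "u \<in> Units A"
  shows "u [^] (k::nat) \<in> Units A"
  by (induction k) (use assms in auto)

lemma int_pow_Units:
  assumes "u \<in> Units A"
  shows "u [^] (z::int) \<in> Units A"
  using nat_pow_Units[OF assms] unfolding int_pow_def2 by (auto simp del: pow_nat)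

lemma sign_commute_inv:
  assumes "x \<in> carrier A" "u \<in> Units A" "x \<otimes> u = sign_of c \<odot> (u \<otimes> x)"
  shows "x \<otimes> inv u = sign_of c \<odot> (inv u \<otimes> x)"
  by (rule sign_commute_inverse[OF assms(1) Units_closed[OF assms(2)] Units_inv_closed[OF assms(2)]
      Units_r_inv[OF assms(2)] Units_l_inv[OF assms(2)] assms(3)])

lemma sign_commute_pow:
  assumes x: "x \<in> carrier A" and u: "u \<in> carrier A" and xu: "x \<otimes> u = sign_of c \<odot> (u \<otimes> x)"
  shows "x \<otimes> u [^] (k::nat) = sign_of (c \<and> odd k) \<odot> (u [^] k \<otimes> x)"
proof (induction k)
  case 0
  then show ?case using x by simp
next
  case (Suc k)
  have "((c \<and> odd k) \<noteq> c) = (c \<and> odd (Suc k))" by auto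
  then show ?case
    using sign_commute_mult[OF x nat_pow_closed[OF u] u Suc xu] by simp
qed

lemma sign_commute_int_pow:
  assumes x: "x \<in> carrier A" and u: "u \<in> Units A" and xu: "x \<otimes> u = sign_of c \<odot> (u \<otimes> x)"
  shows "x \<otimes> u [^] (z::int) = sign_of (c \<and> odd z) \<odot> (u [^] z \<otimes> x)"
proof -
  note pow = sign_commute_pow[OF x Units_closed[OF u] xu]
  show ?thesis
  proof (cases "z < 0")
    case True
    then have "odd (nat (- z)) = odd z" by (simp add: even_nat_iff)
    with sign_commute_inv[OF x nat_pow_Units[OF u] pow[of "nat (- z)"]] True show ?thesis
      by (simp only: int_pow_def2 if_True)
  next
    case False
    then have "odd (nat z) = odd z" by (simp add: even_nat_iff)
    with pow[of "nat z"] False show ?thesis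
      by (simp only: int_pow_def2 if_False)
  qed
qed

lemma Units_nonzero:
  assumes "u \<in> Units A" "\<one> \<noteq> \<zero>"
  shows "u \<noteq> \<zero>"
  using assms Units_r_inv Units_inv_closed l_null by metis

text \<open>
  If two units commute and also anticommute, then twice their product vanishes, which is absurd when
  \<open>2\<close> is invertible and the algebra is not zero.
\<close>

lemma sign_commute_unique:
  assumes two: "(2::'a) \<noteq> 0" and one: "\<one> \<noteq> \<zero>"
    and u: "u \<in> Units A" and x: "x \<in> Units A"
    and "u \<otimes> x = x \<otimes> u" "u \<otimes> x = sign_of c \<odot> (x \<otimes> u)"
  shows "\<not> c"
proof
  assume c
  have w: "x \<otimes> u \<in> Units A" using u x by (rule Units_m_closed[rotated])
  then have wc: "x \<otimes> u \<in> carrier A" by (rule Units_closed)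
  have "u \<otimes> x = \<ominus> (x \<otimes> u)"
    using assms(6) \<open>c\<close> smult_minus_one[OF wc] by (simp add: sign_of_def)
  then have "x \<otimes> u \<oplus> u \<otimes> x = \<zero>" using r_neg[OF wc] by simp
  then have "(1 + 1) \<odot> (x \<otimes> u) = \<zero>"
    unfolding smult_l_distr[OF wc] smult_one[OF wc] assms(5) .
  then have "(inverse 2 * 2) \<odot> (x \<otimes> u) = \<zero>"
    by (simp only: smult_smult[OF wc, symmetric] one_add_one smult_zero_right)
  then have "x \<otimes> u = \<zero>" using two wc by simp
  then show False using Units_nonzero[OF w one] by simp
qed

lemma smult_in_centre:
  assumes "x \<in> centre A"
  shows "c \<odot> x \<in> centre A"
  using assms by (auto simp: centre_def smult_mult_left smult_mult_right)

end

lemma torus_gen_Units: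
  assumes "i < dim_row q"
  shows "torus_gen q i \<in> Units (quantum_torus q)"
  by (rule unital_algebra.Units_I[OF unital_algebra_quantum_torus
        toral_systemD(1-4)[OF toral_system_torus_gen assms]])

lemma torus_monomial_Units: "torus_monomial q \<alpha> \<in> Units (quantum_torus q)"
proof -
  interpret unital_algebra "quantum_torus q" by (rule unital_algebra_quantum_torus)
  have "foldr (\<otimes>\<^bsub>quantum_torus q\<^esub>)
      (map (\<lambda>i. torus_gen q i [^]\<^bsub>quantum_torus q\<^esub> Poly_Mapping.lookup \<alpha> i) is)
      \<one>\<^bsub>quantum_torus q\<^esub> \<in> Units (quantum_torus q)" if "\<forall>i\<in>set is. i < dim_row q" for "is"
    using that by (induction "is") (auto intro!: Units_m_closed int_pow_Units torus_gen_Units)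
  then show ?thesis by (simp add: torus_monomial_def)
qed

text \<open>
  Passing \<open>t\<^sub>k\<close> through \<open>t\<^sub>i\<^bsup>\<alpha>\<^sub>i\<^esup>\<close> costs the sign of \<open>b i k\<close> exactly when \<open>\<alpha>\<^sub>i\<close> is odd, so the total sign is the
  value of the form on \<open>\<alpha>\<close> modulo two and the basis vector \<open>k\<close>.
\<close>

lemma torus_gen_monomial_commute:
  assumes k: "k < n"
  shows "torus_gen (sign_mat n b :: 'a::field mat) k \<otimes>\<^bsub>quantum_torus (sign_mat n b)\<^esub> torus_monomial (sign_mat n b) \<alpha>
    = sign_of (odd (card {i. i < n \<and> b i k \<and> odd (Poly_Mapping.lookup \<alpha> i)}))
        \<odot>\<^bsub>quantum_torus (sign_mat n b)\<^esub>
      (torus_monomial (sign_mat n b) \<alpha> \<otimes>\<^bsub>quantum_torus (sign_mat n b)\<^esub> torus_gen (sign_mat n b) k)"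
proof -
  let ?q = "sign_mat n b :: 'a mat"
  define A where "A = quantum_torus ?q"
  interpret A: unital_algebra A unfolding A_def by (rule unital_algebra_quantum_torus)
  let ?t = "torus_gen ?q" and ?m = "\<lambda>i. torus_gen ?q i [^]\<^bsub>A\<^esub> Poly_Mapping.lookup \<alpha> i"
  let ?M = "\<lambda>is. foldr (\<otimes>\<^bsub>A\<^esub>) (map ?m is) \<one>\<^bsub>A\<^esub>"
  have U: "?t i \<in> Units A" if "i < n" for i
    using torus_gen_Units[of i ?q] that by (simp add: A_def)
  have t: "?t i \<in> carrier A" if "i < n" for i using A.Units_closed[OF U[OF that]] .
  have tt: "?t k \<otimes>\<^bsub>A\<^esub> ?t i = sign_of (b i k) \<odot>\<^bsub>A\<^esub> (?t i \<otimes>\<^bsub>A\<^esub> ?t k)" if "i < n" for i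
    using toral_systemD(5)[OF toral_system_torus_gen[of ?q], of i k] that k by (simp add: A_def)
  have "?M is \<in> carrier A \<and>
      ?t k \<otimes>\<^bsub>A\<^esub> ?M is = sign_of (odd (card {i \<in> set is. b i k \<and> odd (Poly_Mapping.lookup \<alpha> i)}))
        \<odot>\<^bsub>A\<^esub> (?M is \<otimes>\<^bsub>A\<^esub> ?t k)"
    if "distinct is" "\<forall>i\<in>set is. i < n" for "is"
    using that
  proof (induction "is")
    case Nil
    then show ?case using t[OF k] by simp
  next
    case (Cons i "is")
    then have i: "i < n" "i \<notin> set is" by auto
    have IH: "?M is \<in> carrier A" "?t k \<otimes>\<^bsub>A\<^esub> ?M is
        = sign_of (odd (card {i \<in> set is. b i k \<and> odd (Poly_Mapping.lookup \<alpha> i)})) \<odot>\<^bsub>A\<^esub> (?M is \<otimes>\<^bsub>A\<^esub> ?t k)"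
      using Cons by auto
    have m: "?m i \<in> carrier A" using A.int_pow_Units[OF U[OF i(1)]] by (rule A.Units_closed)
    let ?P = "\<lambda>i. b i k \<and> odd (Poly_Mapping.lookup \<alpha> i)"
    have "{j \<in> set (i # is). ?P j} = (if ?P i then insert i {j \<in> set is. ?P j} else {j \<in> set is. ?P j})"
      by auto
    then have "odd (card {j \<in> set (i # is). ?P j}) = (?P i \<noteq> odd (card {j \<in> set is. ?P j}))"
      using i(2) by (cases "b i k"; cases "odd (Poly_Mapping.lookup \<alpha> i)") simp_all
    moreover note A.sign_commute_mult[OF t[OF k] m IH(1)
      A.sign_commute_int_pow[OF t[OF k] U[OF i(1)] tt[OF i(1)]] IH(2)]
    ultimately show ?case using m IH(1) by simp
  qed
  from this[of "[0..<n]"] show ?thesis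
    by (simp add: torus_monomial_def A_def)
qed

lemma centralI:
  assumes z: "z \<in> carrier (quantum_torus q)"
    and comm: "\<And>i. i < dim_row q \<Longrightarrow> torus_gen q i \<otimes>\<^bsub>quantum_torus q\<^esub> z = z \<otimes>\<^bsub>quantum_torus q\<^esub> torus_gen q i"
  shows "z \<in> centre (quantum_torus q)"
proof -
  interpret unital_algebra "quantum_torus q" by (rule unital_algebra_quantum_torus)
  have "z \<otimes>\<^bsub>quantum_torus q\<^esub> x = x \<otimes>\<^bsub>quantum_torus q\<^esub> z" if "x \<in> carrier (quantum_torus q)" for x
    using that
  proof (induction rule: torus_induct)
    case one
    show ?case using z by simp
  next
    case (gen i)
    then show ?case using comm by simp
  next
    case (inv_gen i)
    note t = toral_systemD(1-4)[OF toral_system_torus_gen inv_gen]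
    have "z \<otimes>\<^bsub>quantum_torus q\<^esub> torus_gen q i
        = sign_of False \<odot>\<^bsub>quantum_torus q\<^esub> (torus_gen q i \<otimes>\<^bsub>quantum_torus q\<^esub> z)"
      using comm[OF inv_gen] z t by simp
    from sign_commute_inverse[OF z t this] show ?case using z t by simp
  next
    case (add x y)
    then show ?case using z by (simp add: l_distr r_distr)
  next
    case (mult x y)
    let ?mult = "(\<otimes>\<^bsub>quantum_torus q\<^esub>)"
    have "?mult z (?mult x y) = ?mult (?mult x z) y" using mult z by (simp flip: m_assoc)
    also have "\<dots> = ?mult x (?mult y z)" using mult z by (simp add: m_assoc)
    also have "\<dots> = ?mult (?mult x y) z" using mult z by (simp add: m_assoc)
    finally show ?case .
  next
    case (smult c x)
    then show ?case using z by (simp add: smult_mult_left smult_mult_right)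
  qed
  then show ?thesis using z by (simp add: centre_def)
qed

text \<open>
  Centrality only has to be tested on the generators, and since \<open>2 \<noteq> 0\<close> a unit cannot both commute and
  anticommute with a monomial; so central monomials correspond to the radical of the form modulo two.
\<close>

lemma torus_monomial_central_iff:
  fixes b :: "nat \<Rightarrow> nat \<Rightarrow> bool" and n :: nat
  defines "A \<equiv> (quantum_torus (sign_mat n b) :: ('a::field, 'a torus_element) module)"
  assumes two: "(2::'a) \<noteq> 0" and one: "\<one>\<^bsub>A\<^esub> \<noteq> \<zero>\<^bsub>A\<^esub>"
  shows "torus_monomial (sign_mat n b) \<alpha> \<in> centre A
    \<longleftrightarrow> (\<forall>k<n. even (card {i. i < n \<and> b i k \<and> odd (Poly_Mapping.lookup \<alpha> i)}))"
proof -
  let ?q = "sign_mat n b :: 'a mat"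
  let ?\<chi> = "\<lambda>k. odd (card {i. i < n \<and> b i k \<and> odd (Poly_Mapping.lookup \<alpha> i)})"
  interpret A: unital_algebra A unfolding A_def by (rule unital_algebra_quantum_torus)
  let ?m = "torus_monomial ?q \<alpha>"
  have m: "?m \<in> Units A" unfolding A_def by (rule torus_monomial_Units)
  then have mc: "?m \<in> carrier A" by (rule A.Units_closed)
  have t: "torus_gen ?q k \<in> Units A" if "k < n" for k
    using torus_gen_Units[of k ?q] that by (simp add: A_def)
  have comm: "torus_gen ?q k \<otimes>\<^bsub>A\<^esub> ?m = sign_of (?\<chi> k) \<odot>\<^bsub>A\<^esub> (?m \<otimes>\<^bsub>A\<^esub> torus_gen ?q k)"
    if "k < n" for k
    unfolding A_def by (rule torus_gen_monomial_commute[OF that])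
  show ?thesis
  proof
    assume c: "?m \<in> centre A"
    have "\<not> ?\<chi> k" if k: "k < n" for k
    proof (rule A.sign_commute_unique[OF two one t[OF k] m _ comm[OF k]])
      show "torus_gen ?q k \<otimes>\<^bsub>A\<^esub> ?m = ?m \<otimes>\<^bsub>A\<^esub> torus_gen ?q k"
        using c A.Units_closed[OF t[OF k]] by (simp add: centre_def)
    qed
    then show "\<forall>k<n. even (card {i. i < n \<and> b i k \<and> odd (Poly_Mapping.lookup \<alpha> i)})" by blast
  next
    assume even: "\<forall>k<n. even (card {i. i < n \<and> b i k \<and> odd (Poly_Mapping.lookup \<alpha> i)})"
    have "torus_gen ?q k \<otimes>\<^bsub>A\<^esub> ?m = ?m \<otimes>\<^bsub>A\<^esub> torus_gen ?q k" if "k < n" for k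
      using comm[OF that] even[rule_format, OF that] mc A.Units_closed[OF t[OF that]] by simp
    then show "?m \<in> centre A"
      using centralI[of ?m ?q] mc by (simp add: A_def)
  qed
qed

lemma centre_iso_iff:
  assumes \<theta>: "\<theta> \<in> algebra_isos A B" and A: "unital_algebra A" and x: "x \<in> carrier A"
  shows "\<theta> x \<in> centre B \<longleftrightarrow> x \<in> centre A"
proof -
  interpret unital_algebra A by (rule A)
  have h: "\<theta> \<in> algebra_hom A B" and bij: "bij_betw \<theta> (carrier A) (carrier B)"
    using \<theta> by (auto simp: algebra_isos_iff)
  note h = algebra_homD[OF h]
  have surj: "carrier B = \<theta> ` carrier A" and inj: "inj_on \<theta> (carrier A)"
    using bij by (auto simp: bij_betw_def)
  have "(\<theta> x \<otimes>\<^bsub>B\<^esub> \<theta> y = \<theta> y \<otimes>\<^bsub>B\<^esub> \<theta> x) = (x \<otimes>\<^bsub>A\<^esub> y = y \<otimes>\<^bsub>A\<^esub> x)" if "y \<in> carrier A" for y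
    using inj_on_eq_iff[OF inj m_closed[OF x that] m_closed[OF that x]] h(2)[OF x that] h(2)[OF that x] by simp
  then show ?thesis using x by (simp add: centre_def surj)
qed

text \<open>
  The other index of the hyperbolic plane that contains \<open>k\<close>.
\<close>

definition partner :: "nat \<Rightarrow> nat" where
  "partner k = (if even k then Suc k else k - 1)"

lemma partner_partner [simp]: "partner (partner k) = k"
  by (auto simp: partner_def elim: oddE)

lemma hyperbolic_iff_partner: "hyperbolic l i k \<longleftrightarrow> k < 2 * l \<and> i = partner k"
proof -
  have "(i \<noteq> k \<and> i div 2 = k div 2) \<longleftrightarrow> i = partner k"
    by (auto simp: partner_def elim!: evenE oddE)
  moreover have "i < 2 * l \<longleftrightarrow> k < 2 * l" if "i div 2 = k div 2"
    using same_pair_less[of i k l] same_pair_less[of k i l] that by auto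
  ultimately show ?thesis by (auto simp: hyperbolic_def)
qed

lemma partner_less: "k < 2 * l \<Longrightarrow> partner k < 2 * l"
  by (auto simp: partner_def elim!: evenE)

lemma hyperbolic_parity:
  assumes "2 * l \<le> n" "k < 2 * l"
  shows "odd (card {i. i < n \<and> hyperbolic l i k \<and> P i}) \<longleftrightarrow> P (partner k)"
proof -
  have "{i. i < n \<and> hyperbolic l i k \<and> P i} = (if P (partner k) then {partner k} else {})"
    using assms partner_less[of k l] by (auto simp: hyperbolic_iff_partner)
  then show ?thesis by simp
qed

text \<open>
  The planes are nondegenerate and the rest of the form is zero, so the radical consists of the
  vectors whose coordinates in the planes vanish modulo two.
\<close>

lemma hyperbolic_radical:
  assumes l: "2 * l \<le> n"
  shows "(\<forall>k<n. even (card {i. i < n \<and> hyperbolic l i k \<and> odd (f i)})) \<longleftrightarrow> (\<forall>i<2*l. even (f i :: int))"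
proof
  assume L: "\<forall>k<n. even (card {i. i < n \<and> hyperbolic l i k \<and> odd (f i)})"
  show "\<forall>i<2*l. even (f i)"
  proof (intro allI impI)
    fix i assume "i < 2 * l"
    then have "partner i < 2 * l" by (rule partner_less)
    then show "even (f i)"
      using L hyperbolic_parity[OF l, of "partner i" "\<lambda>i. odd (f i)"] l by auto
  qed
next
  assume R: "\<forall>i<2*l. even (f i)"
  show "\<forall>k<n. even (card {i. i < n \<and> hyperbolic l i k \<and> odd (f i)})"
  proof (intro allI impI)
    fix k assume "k < n"
    show "even (card {i. i < n \<and> hyperbolic l i k \<and> odd (f i)})"
    proof (cases "k < 2 * l")
      case True
      then show ?thesis
        using hyperbolic_parity[OF l True, of "\<lambda>i. odd (f i)"] R partner_less by blast
    qed (simp add: hyperbolic_iff_partner)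
  qed
qed

section \<open>Matrix representations\<close>

lemma unital_algebra_mat: "unital_algebra (module_mat TYPE('a::field) N N)"
proof -
  have "module_mat TYPE('a) N N = ring_mat TYPE('a) N \<lparr>smult = (\<cdot>\<^sub>m)\<rparr>"
    by (simp add: module_mat_def ring_mat_def)
  then have "ring (module_mat TYPE('a) N N)"
    using ring_mat[of N "\<lparr>smult = (\<cdot>\<^sub>m)\<rparr>", where 'a = 'a] by simp
  then interpret ring "module_mat TYPE('a) N N" .
  show ?thesis
    by unfold_locales
      (auto simp: module_mat_simps add_smult_distrib_right_mat add_smult_distrib_left_mat
        mult_smult_assoc_mat mult_smult_distrib intro!: eq_matI)
qed

text \<open>
  Row \<open>a\<close> has a single nonzero entry, a sign in column \<open>f a\<close>; such matrices multiply by composing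
  the maps and collecting the signs.
\<close>

definition signed_map_mat :: "nat \<Rightarrow> (nat \<Rightarrow> bool) \<Rightarrow> (nat \<Rightarrow> nat) \<Rightarrow> 'a::field mat" where
  "signed_map_mat N s f = mat N N (\<lambda>(a, c). if c = f a then sign_of (s a) else 0)"

lemma signed_map_mat_closed [simp]: "signed_map_mat N s f \<in> carrier_mat N N"
  by (simp add: signed_map_mat_def)

lemma signed_map_mat_mult:
  assumes "\<And>a. a < N \<Longrightarrow> f a < N"
  shows "signed_map_mat N s f * signed_map_mat N s' f'
    = (signed_map_mat N (\<lambda>a. s a \<noteq> s' (f a)) (f' \<circ> f) :: 'a::field mat)"
proof (rule eq_matI)
  fix a c assume "a < dim_row (signed_map_mat N (\<lambda>a. s a \<noteq> s' (f a)) (f' \<circ> f) :: 'a mat)"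
    "c < dim_col (signed_map_mat N (\<lambda>a. s a \<noteq> s' (f a)) (f' \<circ> f) :: 'a mat)"
  then have ac: "a < N" "c < N" by (simp_all add: signed_map_mat_def)
  have "(signed_map_mat N s f * signed_map_mat N s' f') $$ (a, c)
      = (\<Sum>d\<in>{0..<N}. (if d = f a then sign_of (s a) else 0) * (if c = f' d then sign_of (s' d) else 0 :: 'a))"
    using ac by (simp add: signed_map_mat_def scalar_prod_def)
  also have "\<dots> = (\<Sum>d\<in>{0..<N}. if d = f a then (if c = f' d then sign_of (s a) * sign_of (s' d) else 0) else 0)"
    by (rule sum.cong) auto
  also have "\<dots> = (if c = f' (f a) then sign_of (s a \<noteq> s' (f a)) else 0)"
    using ac assms by simp
  also have "\<dots> = signed_map_mat N (\<lambda>a. s a \<noteq> s' (f a)) (f' \<circ> f) $$ (a, c)"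
    using ac by (simp add: signed_map_mat_def)
  finally show "(signed_map_mat N s f * signed_map_mat N s' f' :: 'a mat) $$ (a, c)
      = signed_map_mat N (\<lambda>a. s a \<noteq> s' (f a)) (f' \<circ> f) $$ (a, c)" .
qed (simp_all add: signed_map_mat_def)

lemma signed_map_mat_cong:
  assumes "\<And>a. a < N \<Longrightarrow> s a = s' a" "\<And>a. a < N \<Longrightarrow> f a = f' a"
  shows "signed_map_mat N s f = signed_map_mat N s' f'"
  by (rule eq_matI) (auto simp: signed_map_mat_def assms)

lemma signed_map_mat_one: "signed_map_mat N (\<lambda>a. False) (\<lambda>a. a) = 1\<^sub>m N"
  by (rule eq_matI) (auto simp: signed_map_mat_def)

lemma signed_map_mat_smult:
  "sign_of c \<cdot>\<^sub>m signed_map_mat N s f = signed_map_mat N (\<lambda>a. c \<noteq> s a) f"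
  by (rule eq_matI) (auto simp: signed_map_mat_def)

lemma flip_bit_less:
  fixes a :: nat
  assumes "a < 2 ^ l" "i < l"
  shows "flip_bit i a < 2 ^ l"
proof -
  have "take_bit l (flip_bit i a) = flip_bit i a"
    using assms by (simp add: take_bit_flip_bit_eq take_bit_nat_eq_self)
  then show ?thesis by (simp only: take_bit_nat_eq_self_iff)
qed

lemma bit_flip_bit_nat: "bit (flip_bit j a) i = (bit a i \<noteq> (i = j))" for a :: nat
  by (auto simp: bit_flip_bit_iff)

lemma flip_bit_involution: "flip_bit i (flip_bit i a) = a" for a :: nat
  by (rule bit_eqI) (auto simp: bit_flip_bit_nat)

lemma flip_bit_commute: "flip_bit i (flip_bit j a) = flip_bit j (flip_bit i a)" for a :: nat
  by (rule bit_eqI) (auto simp: bit_flip_bit_nat)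

text \<open>
  This is the representation by Pauli matrices on the tensor power of \<open>l\<close> planes. Its basis vectors are
  indexed by the numbers below \<open>2 ^ l\<close>, read as bit strings. The generator \<open>2 i\<close> acts by the sign of
  bit \<open>i\<close>, the generator \<open>2 i + 1\<close> flips bit \<open>i\<close>, and the remaining generators act trivially. Flipping
  a bit changes only its own sign, so the generators of one plane anticommute and all other pairs
  commute.
\<close>

lemma h_torus_matrix_representation:
  obtains \<rho> where "\<rho> \<in> algebra_hom (quantum_torus (sign_mat n (hyperbolic l) :: 'a::field mat))
    (module_mat TYPE('a) (2 ^ l) (2 ^ l))"
proof -
  let ?N = "2 ^ l :: nat"
  define s where "s k a \<longleftrightarrow> even k \<and> k < 2 * l \<and> bit a (k div 2)" for k a :: nat
  define f where "f k a = (if odd k \<and> k < 2 * l then flip_bit (k div 2) a else a)" for k a :: nat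
  define t where "t k = (signed_map_mat ?N (s k) (f k) :: 'a mat)" for k
  have f: "f k a < ?N" if "a < ?N" for k a
    using that flip_bit_less[of a l "k div 2"] by (auto simp: f_def)
  have mult: "t j * t i = signed_map_mat ?N (\<lambda>a. s j a \<noteq> s i (f j a)) (f i \<circ> f j)" for i j
    unfolding t_def by (rule signed_map_mat_mult) (rule f)
  have "f k (f k a) = a" "(s k a \<noteq> s k (f k a)) = False" for k a
    by (auto simp: f_def s_def flip_bit_involution)
  then have sq: "t k * t k = 1\<^sub>m ?N" for k
    unfolding mult signed_map_mat_one[symmetric] by (intro signed_map_mat_cong) auto
  have ff: "f i (f j a) = f j (f i a)" for i j a
    by (simp add: f_def flip_bit_commute)
  have sf: "s i (f j a) = (s i a \<noteq> (even i \<and> odd j \<and> hyperbolic l i j))" for i j a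
    using same_pair_less[of i j l]
    by (auto simp: s_def f_def bit_flip_bit_nat hyperbolic_def)
  have hyp: "hyperbolic l i j \<Longrightarrow> even i \<noteq> even j" "hyperbolic l i j = hyperbolic l j i" for i j
    using alternating_hyperbolic[of l] by (auto simp: hyperbolic_iff_partner partner_def alternating_def)
  have comm: "t j * t i = sign_of (hyperbolic l i j) \<cdot>\<^sub>m (t i * t j)" for i j
    unfolding mult signed_map_mat_smult
  proof (rule signed_map_mat_cong)
    show "(s j a \<noteq> s i (f j a)) = (hyperbolic l i j \<noteq> (s i a \<noteq> s j (f i a)))" for a
      unfolding sf using hyp(1)[of i j] hyp(2)[of i j] by blast
  qed (simp add: ff)
  have "toral_system (module_mat TYPE('a) ?N ?N) (sign_mat n (hyperbolic l)) t t"
    unfolding toral_system_def module_mat_simps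
  proof (intro conjI allI impI)
    fix i j assume "i < dim_row (sign_mat n (hyperbolic l) :: 'a mat)"
      and "j < dim_row (sign_mat n (hyperbolic l) :: 'a mat)"
    then have ij: "i < n" "j < n" by simp_all
    show "t j * t i = sign_mat n (hyperbolic l) $$ (i, j) \<cdot>\<^sub>m (t i * t j)"
      unfolding sign_mat_simps(3)[OF ij] by (rule comm)
  qed (simp_all add: sq, simp_all add: t_def)
  from quantum_torus_universal[OF unital_algebra_mat this] that show ?thesis by blast
qed

section \<open>Linear independence of the images of monomials\<close>

text \<open>
  Simultaneous eigenvectors that are separated by their eigenvalues are linearly independent. In a
  nontrivial relation with two nonzero coefficients at \<open>s\<close> and \<open>s'\<close>, applying an operator that
  separates them and subtracting \<open>\<chi> s\<close> times the relation kills the coefficient at \<open>s\<close> but not the one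
  at \<open>s'\<close>, so the relation gets shorter. The separating operator may depend on the pair.
\<close>

lemma (in vector_space) eigenvectors_relation:
  assumes I: "finite I" and nz: "\<And>s. s \<in> I \<Longrightarrow> v s \<noteq> 0"
    and sep: "\<And>s s'. s \<in> I \<Longrightarrow> s' \<in> I \<Longrightarrow> s \<noteq> s' \<Longrightarrow>
      \<exists>T \<chi>. module_hom scale scale T \<and> (\<forall>r\<in>I. T (v r) = scale (\<chi> r) (v r)) \<and> \<chi> s \<noteq> \<chi> s'"
    and rel: "(\<Sum>s\<in>I. scale (c s) (v s)) = 0" and s: "s \<in> I"
  shows "c s = 0"
  using rel s
proof (induction "card {s \<in> I. c s \<noteq> 0}" arbitrary: c s rule: less_induct)
  case less
  show ?case
  proof (rule ccontr)
    assume cs: "c s \<noteq> 0"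
    show False
    proof (cases "\<exists>s'\<in>I. s' \<noteq> s \<and> c s' \<noteq> 0")
      case True
      then obtain s' where s': "s' \<in> I" "s' \<noteq> s" "c s' \<noteq> 0" by blast
      obtain T \<chi> where T: "module_hom scale scale T" "\<And>r. r \<in> I \<Longrightarrow> T (v r) = scale (\<chi> r) (v r)"
        "\<chi> s \<noteq> \<chi> s'"
        using sep[OF less.prems(2) s'(1)] s'(2) by blast
      have "0 = T (\<Sum>r\<in>I. scale (c r) (v r))"
        using less.prems(1) module_hom.zero[OF T(1)] by simp
      also have "\<dots> = (\<Sum>r\<in>I. scale (c r * \<chi> r) (v r))"
        by (simp add: module_hom.sum[OF T(1)] module_hom.scale[OF T(1)] T(2))
      finally have "(\<Sum>r\<in>I. scale (c r * \<chi> r) (v r)) - scale (\<chi> s) (\<Sum>r\<in>I. scale (c r) (v r)) = 0"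
        using less.prems(1) by simp
      then have rel': "(\<Sum>r\<in>I. scale (c r * (\<chi> r - \<chi> s)) (v r)) = 0"
        by (simp add: scale_sum_right right_diff_distrib scale_left_diff_distrib sum_subtractf
            mult.commute[of "\<chi> s"])
      have "{r \<in> I. c r * (\<chi> r - \<chi> s) \<noteq> 0} \<subset> {r \<in> I. c r \<noteq> 0}"
        using cs less.prems(2) by auto
      then have "card {r \<in> I. c r * (\<chi> r - \<chi> s) \<noteq> 0} < card {r \<in> I. c r \<noteq> 0}"
        using I by (intro psubset_card_mono) auto
      from less.hyps[OF this rel' s'(1)] show False using s'(3) T(3) by simp
    next
      case False
      then have "(\<Sum>r\<in>I. scale (c r) (v r)) = (\<Sum>r\<in>I. if r = s then scale (c s) (v s) else 0)"
        by (intro sum.cong) auto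
      then have "scale (c s) (v s) = 0" using less.prems I by simp
      then show False using cs nz[OF less.prems(2)] by simp
    qed
  qed
qed

lemma (in vector_space) eigenvectors_card_le:
  assumes I: "finite I" and nz: "\<And>s. s \<in> I \<Longrightarrow> v s \<noteq> 0"
    and sep: "\<And>s s'. s \<in> I \<Longrightarrow> s' \<in> I \<Longrightarrow> s \<noteq> s' \<Longrightarrow>
      \<exists>T \<chi>. module_hom scale scale T \<and> (\<forall>r\<in>I. T (v r) = scale (\<chi> r) (v r)) \<and> \<chi> s \<noteq> \<chi> s'"
    and D: "finite D" "v ` I \<subseteq> span D"
  shows "card I \<le> card D"
proof -
  have indep: "c s = 0" if "(\<Sum>s\<in>I. scale (c s) (v s)) = 0" "s \<in> I" for c s
    using eigenvectors_relation[of I v c s] I nz sep that by blast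
  have inj: "inj_on v I"
  proof (rule inj_onI, rule ccontr)
    fix s s' assume ss: "s \<in> I" "s' \<in> I" "v s = v s'" "s \<noteq> s'"
    define c :: "'c \<Rightarrow> 'a" where "c r = (if r = s then 1 else 0) - (if r = s' then 1 else 0)" for r
    have "(\<Sum>r\<in>I. scale (c r) (v r))
        = (\<Sum>r\<in>I. if r = s then v s else 0) - (\<Sum>r\<in>I. if r = s' then v s' else 0)"
      unfolding sum_subtractf[symmetric] by (intro sum.cong) (auto simp: c_def)
    also have "\<dots> = 0" using ss I by simp
    finally have "c s = 0" using indep ss by blast
    then show False using ss by (simp add: c_def)
  qed
  have "independent (v ` I)"
  proof
    assume "dependent (v ` I)"
    then obtain u s where "s \<in> I" "u (v s) \<noteq> 0" "(\<Sum>w\<in>v ` I. scale (u w) w) = 0"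
      unfolding dependent_finite[OF finite_imageI[OF I]] by blast
    then show False
      using indep[of "\<lambda>s. u (v s)" s] by (simp add: sum.reindex[OF inj])
  qed
  from independent_span_bound[OF D(1) this D(2)] show ?thesis
    by (simp add: card_image[OF inj])
qed

lemma vector_space_functions: "vector_space (\<lambda>(c::'a::field) (f :: 'x \<Rightarrow> 'a) x. c * f x)"
  by unfold_locales (auto simp: fun_eq_iff algebra_simps)

text \<open>
  For \<open>S \<subseteq> {..<2k}\<close>, the monomial \<open>\<Prod>\<^bsub>i\<in>S\<^esub> t\<^sub>i\<close> is an eigenvector of conjugation by each generator.
  Conjugation by the partner of \<open>c\<close> has the eigenvalue \<open>- 1\<close> or \<open>1\<close> on it according to whether \<open>c \<in> S\<close>,
  so these eigenvalues determine \<open>S\<close>. The images of the \<open>2 ^ (2 k)\<close> monomials are invertible, hence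
  nonzero, and so they are linearly independent in the space of \<open>N \<times> N\<close> matrices.
\<close>

lemma h_torus_representation_bound:
  fixes \<phi> :: "'a::field torus_element \<Rightarrow> 'a mat"
  assumes two: "(2::'a) \<noteq> 0" and k: "2 * k \<le> m" and N: "0 < N"
    and \<phi>: "\<phi> \<in> algebra_hom (quantum_torus (sign_mat m (hyperbolic k))) (module_mat TYPE('a) N N)"
  shows "2 ^ (2 * k) \<le> N * N"
proof -
  let ?q = "sign_mat m (hyperbolic k) :: 'a mat"
  define A where "A = quantum_torus ?q"
  let ?M = "module_mat TYPE('a) N N"
  interpret A: unital_algebra A unfolding A_def by (rule unital_algebra_quantum_torus)
  interpret V: vector_space "\<lambda>(c::'a) (f :: nat \<times> nat \<Rightarrow> 'a) x. c * f x" by (rule vector_space_functions)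
  note h = algebra_homD[OF \<phi>[folded A_def]]
  define \<alpha> :: "nat set \<Rightarrow> (nat \<Rightarrow>\<^sub>0 int)" where "\<alpha> S = (\<Sum>i\<in>S. frag_of i)" for S
  have \<alpha>: "odd (Poly_Mapping.lookup (\<alpha> S) i) \<longleftrightarrow> i \<in> S" if "S \<subseteq> {..<2 * k}" for S i
    using finite_subset[OF that] by (simp add: \<alpha>_def lookup_sum)
  define X where "X S = \<phi> (torus_monomial ?q (\<alpha> S))" for S
  define g where "g c = \<phi> (torus_gen ?q c)" for c
  define g' where "g' c = \<phi> (torus_inv_gen ?q c)" for c
  have mon: "torus_monomial ?q a \<in> Units A" for a unfolding A_def by (rule torus_monomial_Units)
  have X: "X S \<in> carrier_mat N N" for S
    using h(1)[OF A.Units_closed[OF mon]] by (simp add: X_def module_mat_simps)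
  have t: "torus_gen ?q c \<in> carrier A" "torus_inv_gen ?q c \<in> carrier A"
    "torus_gen ?q c \<otimes>\<^bsub>A\<^esub> torus_inv_gen ?q c = \<one>\<^bsub>A\<^esub>" if "c < m" for c
    using toral_systemD(1-3)[OF toral_system_torus_gen[of ?q], of c] that by (simp_all add: A_def)
  have g: "g c \<in> carrier_mat N N" "g' c \<in> carrier_mat N N" "g c * g' c = 1\<^sub>m N" if "c < m" for c
    using h(1)[OF t(1)[OF that]] h(1)[OF t(2)[OF that]] h(2)[OF t(1,2)[OF that]] h(4) t(3)[OF that]
    by (simp_all add: g_def g'_def module_mat_simps)
  have gX: "g (partner c) * X S * g' (partner c) = sign_of (c \<in> S) \<cdot>\<^sub>m X S"
    if c: "c < 2 * k" and S: "S \<subseteq> {..<2 * k}" for c S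
  proof -
    have p: "partner c < 2 * k" "partner c < m" using partner_less[OF c] k by auto
    have "torus_gen ?q (partner c) \<otimes>\<^bsub>A\<^esub> torus_monomial ?q (\<alpha> S)
        = sign_of (c \<in> S) \<odot>\<^bsub>A\<^esub> (torus_monomial ?q (\<alpha> S) \<otimes>\<^bsub>A\<^esub> torus_gen ?q (partner c))"
      using torus_gen_monomial_commute[OF p(2), of "hyperbolic k" "\<alpha> S", where 'a = 'a]
        hyperbolic_parity[OF k p(1), of "\<lambda>i. odd (Poly_Mapping.lookup (\<alpha> S) i)"]
      by (simp add: A_def \<alpha>[OF S])
    from arg_cong[OF this, of \<phi>]
    have "g (partner c) * X S = sign_of (c \<in> S) \<cdot>\<^sub>m (X S * g (partner c))"
      unfolding h(2)[OF t(1)[OF p(2)] A.Units_closed[OF mon]]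
        h(5)[OF A.m_closed[OF A.Units_closed[OF mon] t(1)[OF p(2)]]]
        h(2)[OF A.Units_closed[OF mon] t(1)[OF p(2)]]
      by (simp only: g_def X_def module_mat_simps)
    then have "g (partner c) * X S * g' (partner c)
        = sign_of (c \<in> S) \<cdot>\<^sub>m (X S * g (partner c) * g' (partner c))"
      using mult_smult_assoc_mat[OF mult_carrier_mat[OF X g(1)[OF p(2)]] g(2)[OF p(2)]] by simp
    also have "X S * g (partner c) * g' (partner c) = X S"
      using assoc_mult_mat[OF X g(1)[OF p(2)] g(2)[OF p(2)]] g(3)[OF p(2)] right_mult_one_mat[OF X] by simp
    finally show ?thesis .
  qed
  have X0: "X S \<noteq> 0\<^sub>m N N" for S
  proof
    assume "X S = 0\<^sub>m N N"
    then have "\<phi> (torus_monomial ?q (\<alpha> S) \<otimes>\<^bsub>A\<^esub> inv\<^bsub>A\<^esub> torus_monomial ?q (\<alpha> S)) = \<zero>\<^bsub>?M\<^esub>"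
      using h(1)[OF A.Units_inv_closed[OF mon]]
        h(2)[OF A.Units_closed[OF mon] A.Units_inv_closed[OF mon]]
        left_mult_zero_mat[OF h(1)[OF A.Units_inv_closed[OF mon], unfolded module_mat_simps]]
      by (simp add: X_def module_mat_simps)
    then have "(1\<^sub>m N :: 'a mat) = 0\<^sub>m N N"
      using A.Units_r_inv[OF mon] h(4) by (simp add: module_mat_simps)
    then have "(1\<^sub>m N :: 'a mat) $$ (0, 0) = 0\<^sub>m N N $$ (0, 0)" by simp
    then show False using N by simp
  qed
  \<comment> \<open>Matrices become functions on index pairs, so that they form a vector space on a whole type.\<close>
  define E :: "'a mat \<Rightarrow> nat \<times> nat \<Rightarrow> 'a" where
    "E Y = (\<lambda>(a, c). if a < N \<and> c < N then Y $$ (a, c) else 0)" for Y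
  define \<delta> :: "nat \<times> nat \<Rightarrow> nat \<times> nat \<Rightarrow> 'a" where "\<delta> p = (\<lambda>x. if x = p then 1 else 0)" for p
  define D where "D = {..<N} \<times> {..<N}"
  have D: "finite D" "card D = N * N" by (simp_all add: D_def card_cartesian_product)
  have sum_app: "(\<Sum>p\<in>P. F p) x = (\<Sum>p\<in>P. F p x)" for P :: "(nat \<times> nat) set" and F :: "nat \<times> nat \<Rightarrow> nat \<times> nat \<Rightarrow> 'a" and x
    by (induction P rule: infinite_finite_induct) auto
  have E_sum: "E Y = (\<Sum>p\<in>D. (\<lambda>x. E Y p * \<delta> p x))" for Y
  proof
    fix x
    show "E Y x = (\<Sum>p\<in>D. (\<lambda>x. E Y p * \<delta> p x)) x"
      unfolding sum_app \<delta>_def using D(1) by (auto simp: E_def D_def if_distrib cong: if_cong split: prod.splits)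
  qed
  have span: "E Y \<in> V.span (\<delta> ` D)" for Y
    by (subst E_sum) (intro V.span_sum V.span_scale V.span_base imageI)
  have E0: "E (X S) \<noteq> 0" for S
  proof
    assume "E (X S) = 0"
    then have entry: "E (X S) (a, c) = 0" for a c by simp
    have "X S $$ (a, c) = 0" if "a < N" "c < N" for a c
      using entry[of a c] that by (simp add: E_def)
    then have "X S = 0\<^sub>m N N" using X[of S]
      by (intro eq_matI) auto
    then show False using X0 by blast
  qed
  have sep: "\<exists>T \<chi>. module_hom (\<lambda>c f x. c * f x) (\<lambda>c f x. c * f x) T
      \<and> (\<forall>R\<in>Pow {..<2*k}. T (E (X R)) = (\<lambda>x. \<chi> R * E (X R) x)) \<and> \<chi> S \<noteq> (\<chi> S' :: 'a)"
    if S: "S \<in> Pow {..<2*k}" "S' \<in> Pow {..<2*k}" "S \<noteq> S'" for S S'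
  proof -
    obtain c where c: "(c \<in> S) \<noteq> (c \<in> S')" "c < 2 * k" using S by blast
    have p: "partner c < m" using partner_less[OF c(2)] k by simp
    \<comment> \<open>Conjugation by the generator that is paired with \<open>c\<close>.\<close>
    define T :: "(nat \<times> nat \<Rightarrow> 'a) \<Rightarrow> nat \<times> nat \<Rightarrow> 'a" where
      "T F = (\<lambda>(a, b). if a < N \<and> b < N
        then \<Sum>e<N. (\<Sum>d<N. g (partner c) $$ (a, d) * F (d, e)) * g' (partner c) $$ (e, b) else 0)" for F
    have "T (E Y) = E (g (partner c) * Y * g' (partner c))" if Y: "Y \<in> carrier_mat N N" for Y
      using Y g(1,2)[OF p]
      by (auto simp del: assoc_mult_mat simp: T_def E_def fun_eq_iff scalar_prod_def atLeast0LessThan)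
    then have "T (E (X R)) = (\<lambda>x. sign_of (c \<in> R) * E (X R) x)" if "R \<in> Pow {..<2*k}" for R
      using gX[OF c(2), of R] that X[of R] by (auto simp: E_def fun_eq_iff)
    moreover have "module_hom (\<lambda>c f x. c * f x) (\<lambda>c f x. c * f x) T"
      by unfold_locales
        (auto simp: T_def fun_eq_iff algebra_simps sum.distrib sum_distrib_left)
    moreover have "sign_of (c \<in> S) \<noteq> (sign_of (c \<in> S') :: 'a)"
    proof -
      have "(1::'a) \<noteq> - 1" using two by (metis add.right_inverse one_add_one)
      then show ?thesis using c(1) by (auto simp: sign_of_def)
    qed
    ultimately show ?thesis by (intro exI[of _ T] exI[of _ "\<lambda>R. sign_of (c \<in> R)"]) auto
  qed
  have "card (Pow {..<2*k}) \<le> card (\<delta> ` D)"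
    by (rule V.eigenvectors_card_le[of _ "\<lambda>S. E (X S)"]) (use E0 sep span D in auto)
  also have "\<dots> \<le> N * N" using card_image_le[OF D(1), of \<delta>] D(2) by simp
  finally show ?thesis by (simp add: card_Pow)
qed

text \<open>
  Compose the isomorphism with the representation of degree \<open>2 ^ l\<close>: the bound on the degree of a
  representation of the source gives \<open>4 ^ k \<le> 4 ^ l\<close>.
\<close>

lemma h_mat_isomorphic_le:
  assumes two: "(2::'a::field) \<noteq> 0" and k: "2 * k \<le> m" and l: "2 * l \<le> n"
    and iso: "algebra_isomorphic (quantum_torus (h_mat k m :: 'a mat)) (quantum_torus (h_mat l n))"
  shows "k \<le> l"
proof -
  obtain \<psi> where \<psi>: "\<psi> \<in> algebra_hom (quantum_torus (sign_mat m (hyperbolic k) :: 'a mat))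
      (quantum_torus (sign_mat n (hyperbolic l)))"
    using iso by (auto simp: algebra_isomorphic_def h_mat_eq_sign_mat k l algebra_isos_iff)
  obtain \<rho> where "\<rho> \<in> algebra_hom (quantum_torus (sign_mat n (hyperbolic l) :: 'a mat))
      (module_mat TYPE('a) (2 ^ l) (2 ^ l))"
    by (rule h_torus_matrix_representation)
  from h_torus_representation_bound[OF two k _ algebra_hom_comp[OF \<psi> this]]
  have "(2::nat) ^ (2 * k) \<le> 2 ^ l * 2 ^ l" by simp
  then have "(2::nat) ^ (2 * k) \<le> 2 ^ (2 * l)" by (simp add: mult_2 power_add)
  then show ?thesis by simp
qed

text \<open>
  The matrix representation shows that the relations do not force \<open>\<one> = \<zero>\<close>.
\<close>

lemma h_torus_nontrivial:
  "\<one>\<^bsub>quantum_torus (sign_mat n (hyperbolic l) :: 'a::field mat)\<^esub>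
    \<noteq> \<zero>\<^bsub>quantum_torus (sign_mat n (hyperbolic l) :: 'a mat)\<^esub>"
proof
  let ?A = "quantum_torus (sign_mat n (hyperbolic l) :: 'a mat)"
  interpret A: unital_algebra ?A by (rule unital_algebra_quantum_torus)
  interpret M: unital_algebra "module_mat TYPE('a) (2 ^ l) (2 ^ l)" by (rule unital_algebra_mat)
  assume "\<one>\<^bsub>?A\<^esub> = \<zero>\<^bsub>?A\<^esub>"
  then have "\<one>\<^bsub>?A\<^esub> = 0 \<odot>\<^bsub>?A\<^esub> \<one>\<^bsub>?A\<^esub>" by simp
  moreover obtain \<rho> where "\<rho> \<in> algebra_hom ?A (module_mat TYPE('a) (2 ^ l) (2 ^ l))"
    by (rule h_torus_matrix_representation)
  note \<rho> = algebra_homD[OF this]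
  ultimately have "\<one>\<^bsub>module_mat TYPE('a) (2 ^ l) (2 ^ l)\<^esub>
      = 0 \<odot>\<^bsub>module_mat TYPE('a) (2 ^ l) (2 ^ l)\<^esub> \<one>\<^bsub>module_mat TYPE('a) (2 ^ l) (2 ^ l)\<^esub>"
    using \<rho>(4) \<rho>(5)[OF A.one_closed, of 0] by metis
  then have "(1\<^sub>m (2 ^ l) :: 'a mat) = 0\<^sub>m (2 ^ l) (2 ^ l)"
    using M.smult_zero_left[OF M.one_closed] by (simp add: module_mat_simps)
  then have "(1\<^sub>m (2 ^ l) :: 'a mat) $$ (0, 0) = 0\<^sub>m (2 ^ l) (2 ^ l) $$ (0, 0)" by simp
  then show False by simp
qed

section \<open>The structure theorem\<close>

lemma quantum_matrix_sign_mat: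
  assumes "alternating b"
  shows "quantum_matrix n (sign_mat n b)"
proof -
  have b: "b i j = b j i" "\<not> b i i" for i j using assms by (auto simp: alternating_def)
  show ?thesis
    unfolding quantum_matrix_def
  proof (intro conjI allI impI)
    show "sign_mat n b \<in> carrier_mat n n" by (rule carrier_matI) simp_all
    show "sign_mat n b $$ (i, i) = 1" if "i < n" for i using that b(2) by simp
    fix i j assume "i < n" "j < n"
    then show "sign_mat n b $$ (i, j) \<noteq> 0" "sign_mat n b $$ (j, i) = inverse (sign_mat n b $$ (i, j))"
      using b(1)[of i j] by (simp_all add: sign_of_def)
  qed
qed

lemma lattice_basis_frag_of: "lattice_basis n frag_of"
proof -
  have "frag_extend frag_of = (\<lambda>x :: nat \<Rightarrow>\<^sub>0 int. x)" using frag_expansion by (metis ext)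
  then show ?thesis by (simp add: lattice_basis_def bij_betw_def)
qed

lemma even_sublattice_eq:
  assumes l: "2 * l \<le> n"
  shows "{\<alpha> \<in> carrier (lattice n). \<forall>i<2*l. even (Poly_Mapping.lookup \<alpha> i)}
    = {(\<Sum>i<2*l. frag_cmul (2 * k i) (frag_of i)) + (\<Sum>i=2*l..<n. frag_cmul (k i) (frag_of i))
       | k :: nat \<Rightarrow> int. True}"
proof -
  let ?c = "\<lambda>k. (\<Sum>i<2*l. frag_cmul (2 * k i) (frag_of i)) + (\<Sum>i=2*l..<n. frag_cmul (k i) (frag_of i))"
  have lk: "Poly_Mapping.lookup (?c k) j = (if j < 2 * l then 2 * k j else if j < n then k j else 0)" for k j
    using l by (auto simp: lookup_add lookup_sum if_distrib cong: if_cong)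
  show ?thesis
  proof (intro equalityI subsetI)
    fix \<alpha> assume "\<alpha> \<in> {\<alpha> \<in> carrier (lattice n). \<forall>i<2*l. even (Poly_Mapping.lookup \<alpha> i)}"
    then have \<alpha>: "\<And>j. n \<le> j \<Longrightarrow> Poly_Mapping.lookup \<alpha> j = 0" "\<forall>i<2*l. even (Poly_Mapping.lookup \<alpha> i)"
      by (auto simp: subset_iff in_keys_iff not_less)
    define k where "k i = (if i < 2 * l then Poly_Mapping.lookup \<alpha> i div 2 else Poly_Mapping.lookup \<alpha> i)" for i
    have "\<alpha> = ?c k"
      by (rule poly_mapping_eqI, unfold lk k_def) (use \<alpha> in auto)
    then show "\<alpha> \<in> {?c k | k. True}" by blast
  next
    fix \<alpha> assume "\<alpha> \<in> {?c k | k. True}"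
    then obtain k where "\<alpha> = ?c k" by blast
    then have "Poly_Mapping.lookup \<alpha> j = (if j < 2 * l then 2 * k j else if j < n then k j else 0)" for j
      by (simp only: lk)
    then show "\<alpha> \<in> {\<alpha> \<in> carrier (lattice n). \<forall>i<2*l. even (Poly_Mapping.lookup \<alpha> i)}"
      using l by (auto simp: in_keys_iff split: if_splits)
  qed
qed

text \<open>
  A homogeneous component is a line spanned by a unit, so it meets the centre nontrivially exactly
  when that unit is central.
\<close>

lemma centre_grading_group_h:
  fixes \<theta> :: "'a::field torus_element \<Rightarrow> 'b"
  assumes two: "(2::'a) \<noteq> 0" and l: "2 * l \<le> n" and A: "unital_algebra A"
    and \<theta>: "\<theta> \<in> algebra_isos (quantum_torus (h_mat l n)) A"
  shows "centre_grading_group n A (\<lambda>\<alpha>. range (\<lambda>c. c \<odot>\<^bsub>A\<^esub> \<theta> (torus_monomial (h_mat l n) \<alpha>)))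
    = {\<alpha> \<in> carrier (lattice n). \<forall>i<2*l. even (Poly_Mapping.lookup \<alpha> i)}"
proof -
  let ?q = "h_mat l n :: 'a mat"
  let ?H = "quantum_torus ?q"
  have q: "?q = sign_mat n (hyperbolic l)" by (rule h_mat_eq_sign_mat[OF l])
  interpret A: unital_algebra A by (rule A)
  interpret H: unital_algebra ?H by (rule unital_algebra_quantum_torus)
  have hom: "\<theta> \<in> algebra_hom ?H A" and inj: "inj_on \<theta> (carrier ?H)"
    using \<theta> by (auto simp: algebra_isos_iff bij_betw_def)
  note h = algebra_homD[OF hom]
  have nontriv: "\<one>\<^bsub>?H\<^esub> \<noteq> \<zero>\<^bsub>?H\<^esub>" unfolding q by (rule h_torus_nontrivial)
  have m: "torus_monomial ?q \<alpha> \<in> carrier ?H" "torus_monomial ?q \<alpha> \<noteq> \<zero>\<^bsub>?H\<^esub>" for \<alpha>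
    using torus_monomial_Units[of ?q \<alpha>] H.Units_closed H.Units_nonzero[OF _ nontriv] by auto
  have "\<theta> \<zero>\<^bsub>?H\<^esub> = \<theta> (0 \<odot>\<^bsub>?H\<^esub> \<zero>\<^bsub>?H\<^esub>)" by simp
  also have "\<dots> = \<zero>\<^bsub>A\<^esub>" using h(5)[OF H.zero_closed, of 0] h(1)[OF H.zero_closed] by simp
  finally have \<theta>0: "\<theta> \<zero>\<^bsub>?H\<^esub> = \<zero>\<^bsub>A\<^esub>" .
  have \<theta>m: "\<theta> (torus_monomial ?q \<alpha>) \<in> carrier A" "\<theta> (torus_monomial ?q \<alpha>) \<noteq> \<zero>\<^bsub>A\<^esub>" for \<alpha>
    using h(1) m inj_on_eq_iff[OF inj m(1) H.zero_closed] \<theta>0 by auto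
  have "(\<exists>z \<in> centre A \<inter> range (\<lambda>c. c \<odot>\<^bsub>A\<^esub> \<theta> (torus_monomial ?q \<alpha>)). z \<noteq> \<zero>\<^bsub>A\<^esub>)
      \<longleftrightarrow> \<theta> (torus_monomial ?q \<alpha>) \<in> centre A" (is "?L \<longleftrightarrow> ?R") for \<alpha>
  proof
    assume ?L
    then obtain c where c: "c \<odot>\<^bsub>A\<^esub> \<theta> (torus_monomial ?q \<alpha>) \<in> centre A"
      "c \<odot>\<^bsub>A\<^esub> \<theta> (torus_monomial ?q \<alpha>) \<noteq> \<zero>\<^bsub>A\<^esub>" by auto
    then have "c \<noteq> 0" using \<theta>m by auto
    then have "\<theta> (torus_monomial ?q \<alpha>) = inverse c \<odot>\<^bsub>A\<^esub> (c \<odot>\<^bsub>A\<^esub> \<theta> (torus_monomial ?q \<alpha>))"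
      using \<theta>m by (simp add: A.smult_smult)
    then show ?R using A.smult_in_centre[OF c(1), of "inverse c"] by simp
  next
    assume ?R
    moreover have "\<theta> (torus_monomial ?q \<alpha>) = 1 \<odot>\<^bsub>A\<^esub> \<theta> (torus_monomial ?q \<alpha>)" using \<theta>m by simp
    ultimately show ?L using \<theta>m(2) by blast
  qed
  also have "\<theta> (torus_monomial ?q \<alpha>) \<in> centre A \<longleftrightarrow> torus_monomial ?q \<alpha> \<in> centre ?H" for \<alpha>
    by (rule centre_iso_iff[OF \<theta> H.unital_algebra_axioms m(1)])
  also have "torus_monomial ?q \<alpha> \<in> centre ?H \<longleftrightarrow> (\<forall>i<2*l. even (Poly_Mapping.lookup \<alpha> i))" for \<alpha>
    using torus_monomial_central_iff[OF two nontriv[unfolded q]] hyperbolic_radical[OF l]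
    unfolding q by blast
  finally show ?thesis unfolding centre_grading_group_def by auto
qed

theorem theorem1p10:
  fixes \<epsilon> :: "'a::field mat" and n :: nat
  assumes "CHAR('a) \<noteq> 2"
    and "elementary_quantum_matrix n \<epsilon>"
  shows "\<exists>l. 2 * l \<le> n
    \<and> algebra_isomorphic (quantum_torus \<epsilon>) (quantum_torus (h_mat l n))
    \<and> (\<exists>\<sigma> G. toral_grading n (quantum_torus \<epsilon>) \<sigma> G
        \<and> centre_grading_group n (quantum_torus \<epsilon>) G =
            {(\<Sum>i<2*l. frag_cmul (2 * k i) (\<sigma> i)) + (\<Sum>i=2*l..<n. frag_cmul (k i) (\<sigma> i))
             | k :: nat \<Rightarrow> int. True})
    \<and> (\<forall>m (\<eta> :: 'a mat) l'.
         elementary_quantum_matrix m \<eta> \<and> 2 * l' \<le> m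
         \<and> algebra_isomorphic (quantum_torus \<eta>) (quantum_torus (h_mat l' m))
         \<and> algebra_isomorphic (quantum_torus \<epsilon>) (quantum_torus \<eta>)
         \<longrightarrow> l' = l)"
proof -
  have two: "(2::'a) \<noteq> 0"
  proof
    assume "(2::'a) = 0"
    then have "CHAR('a) dvd 2" using of_nat_eq_0_iff_char_dvd[of 2, where 'a = 'a] by simp
    moreover from this have "CHAR('a) \<le> 2" by (rule dvd_imp_le) simp
    moreover have "CHAR('a) \<noteq> 0" using calculation(1) by (metis dvd_0_left zero_neq_numeral)
    moreover have "CHAR('a) \<noteq> 1" by simp
    ultimately show False using assms(1) by linarith
  qed
  interpret E: unital_algebra "quantum_torus \<epsilon>" by (rule unital_algebra_quantum_torus)
  obtain l where l: "2 * l \<le> n" and iso: "algebra_isomorphic (quantum_torus \<epsilon>) (quantum_torus (h_mat l n))"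
    by (rule isomorphic_to_h_mat[OF assms(2)])
  obtain \<theta> where \<theta>: "\<theta> \<in> algebra_isos (quantum_torus (h_mat l n)) (quantum_torus \<epsilon>)"
    using E.algebra_isomorphic_sym[OF iso] by (auto simp: algebra_isomorphic_def)
  let ?G = "\<lambda>\<alpha>. range (\<lambda>c. c \<odot>\<^bsub>quantum_torus \<epsilon>\<^esub> \<theta> (torus_monomial (h_mat l n) \<alpha>))"
  have "quantum_matrix n (h_mat l n :: 'a mat)"
    unfolding h_mat_eq_sign_mat[OF l] by (rule quantum_matrix_sign_mat[OF alternating_hyperbolic])
  then have "toral_grading n (quantum_torus \<epsilon>) frag_of ?G"
    unfolding toral_grading_def frag_expansion[symmetric] using lattice_basis_frag_of \<theta> by blast
  moreover have "centre_grading_group n (quantum_torus \<epsilon>) ?G =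
      {(\<Sum>i<2*l. frag_cmul (2 * k i) (frag_of i)) + (\<Sum>i=2*l..<n. frag_cmul (k i) (frag_of i))
       | k :: nat \<Rightarrow> int. True}"
    unfolding centre_grading_group_h[OF two l E.unital_algebra_axioms \<theta>] by (rule even_sublattice_eq[OF l])
  moreover have "l' = l" if "2 * l' \<le> m"
      "algebra_isomorphic (quantum_torus \<eta>) (quantum_torus (h_mat l' m))"
      "algebra_isomorphic (quantum_torus \<epsilon>) (quantum_torus \<eta>)" for m and \<eta> :: "'a mat" and l'
  proof (rule antisym)
    have *: "algebra_isomorphic (quantum_torus (h_mat l n :: 'a mat)) (quantum_torus (h_mat l' m))"
      using algebra_isomorphic_trans[OF algebra_isomorphic_trans[OF E.algebra_isomorphic_sym[OF iso] that(3)] that(2)] .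
    then show "l \<le> l'" by (rule h_mat_isomorphic_le[OF two l that(1)])
    show "l' \<le> l"
      by (rule h_mat_isomorphic_le[OF two that(1) l
            unital_algebra.algebra_isomorphic_sym[OF unital_algebra_quantum_torus *]])
  qed
  ultimately show ?thesis using l iso by blast
qed

end
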